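(* Let $\alpha\in(0,1)$ and $\gamma>0$ be fixed constants. There exists a constant $c=c(\alpha,\gamma)>0$ such that, with probability $1-o(1)$ as $n\to\infty$ over the random graph $G\sim\mathcal{G}(n,\frac12,k=\lfloor n^\alpha\rfloor)$ with planted clique $\mathcal{PC}$, the following holds. For every $h:[n]\to\mathbb{R}$, every $m\in\mathbb{N}$ with $m\ge1$, all inverse temperatures $\beta_1<\beta_2<\dots<\beta_m$, and all estimates $\widehat Z(\beta_i)>0$, $i=1,\dots,m$, there is an initial pair of clique and temperature such that the simulated tempering (ST) dynamics $\{(X_t,I_t)\}$ started from this pair requires, with probability at least $1-\exp(-c\log^2 n)$, at least $\exp(c\log^2 n)$ steps to reach a pair whose clique $X_t$ satisfies $|X_t\cap\mathcal{PC}|\ge\gamma\log n$. In particular, under worst-case initialization the ST dynamics fail to recover the planted clique in polynomial time.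
   Context: Conventions: $\log$ is the base-2 logarithm; $[n]=\{0,1,\dots,n\}$. Planted clique model: $\mathcal{G}(n,\frac12,k)$ is the random graph on an $n$-element vertex set $V$ obtained by sampling $\mathcal{G}(n,\frac12)$ (each pair is an edge independently with probability $1/2$), choosing a uniformly random $k$-subset $\mathcal{PC}\subseteq V$ (the planted clique), and adding all edges between vertices of $\mathcal{PC}$. $\Omega(G)$ denotes the set of all cliques of $G$, i.e. vertex subsets (including $\emptyset$) whose vertices are pairwise adjacent. ST dynamics: given $h:[n]\to\mathbb{R}$ (written $h_q=h(q)$), inverse temperatures $\beta_1<\dots<\beta_m$, positive numbers $\widehat Z(\beta_i)$ (thought of as estimates of the partition functions $Z(\beta_i)=\sum_{C\in\Omega(G)}\exp(\beta_i h_{|C|})$) and a parameter $a\in(0,1)$, this is the Markov chain $\{(X_t,I_t)\}$ on $\Omega(G)\times\{1,\dots,m\}$ with transition probabilities: (level move) for $C,C'\in\Omega(G)$ differing in exactly one vertex, $P((C,i),(C',i))=\frac{a}{n}\min\{1,\exp[\beta_i(h_{|C'|}-h_{|C|})]\}$; (temperature move) for $|i-i'|=1$, $P((C,i),(C,i'))=\frac{1-a}{2}\min\{1,\frac{\widehat Z(\beta_i)}{\widehat Z(\beta_{i'})}\exp[(\beta_{i'}-\beta_i)h_{|C|}]\}$; and the remaining probability is put on staying at the current state. Recovering the planted clique means reaching a state with $X_t=\mathcal{PC}$. *)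

theory Defs
  imports "HOL-Probability.Probability"
begin

section \<open>The planted clique model\<close>

text \<open>Graphs on the vertex set \<open>{..<n}\<close> are represented by their edge sets.\<close>

definition all_pairs :: "nat set \<Rightarrow> nat set set" where
  "all_pairs V = {e. e \<subseteq> V \<and> card e = 2}"

definition random_graph :: "nat \<Rightarrow> nat set set pmf" where
  "random_graph n =
     map_pmf (\<lambda>b. {e \<in> all_pairs {..<n}. b e})
       (Pi_pmf (all_pairs {..<n}) False (\<lambda>_. bernoulli_pmf (1/2)))"

text \<open>The joint law of the graph and its planted clique.\<close>

definition planted_clique :: "nat \<Rightarrow> nat \<Rightarrow> (nat set set \<times> nat set) pmf" where
  "planted_clique n k =
     map_pmf (\<lambda>(E, PC). (E \<union> all_pairs PC, PC))
       (pair_pmf (random_graph n) (pmf_of_set {S. S \<subseteq> {..<n} \<and> card S = k}))"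

definition cliques :: "nat \<Rightarrow> nat set set \<Rightarrow> nat set set" where
  "cliques n E = {C. C \<subseteq> {..<n} \<and> (\<forall>u\<in>C. \<forall>v\<in>C. u \<noteq> v \<longrightarrow> {u, v} \<in> E)}"


section \<open>Markov chains with discrete transition kernel\<close>

text \<open>
  The law on trajectories \<open>\<omega> :: nat \<Rightarrow> 's\<close> of the chain with kernel \<open>K\<close> started at \<open>x\<close>, obtained
  from the Ionescu-Tulcea theorem; \<open>measure_markov_chain_path\<close> below gives its finite-dimensional
  distributions.
\<close>

definition chain_step :: "('s \<Rightarrow> 's pmf) \<Rightarrow> 's \<Rightarrow> nat \<Rightarrow> (nat \<Rightarrow> 's) \<Rightarrow> 's measure" where
  "chain_step K x t \<omega> = measure_pmf (case t of 0 \<Rightarrow> return_pmf x | Suc s \<Rightarrow> K (\<omega> s))"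

definition markov_chain :: "('s \<Rightarrow> 's pmf) \<Rightarrow> 's \<Rightarrow> (nat \<Rightarrow> 's) measure" where
  "markov_chain K x =
     projective_family.lim UNIV
       (Ionescu_Tulcea.CI (chain_step K x) (\<lambda>_. count_space UNIV)) (\<lambda>_. count_space UNIV)"

definition hitting_time :: "'s set \<Rightarrow> (nat \<Rightarrow> 's) \<Rightarrow> enat" where
  "hitting_time A \<omega> = (INF t\<in>{t. \<omega> t \<in> A}. enat t)"

lemma Ionescu_Tulcea_chain_step: "Ionescu_Tulcea (chain_step K x) (\<lambda>_. count_space UNIV)"
proof (rule Ionescu_Tulcea.intro)
  fix t
  show "chain_step K x t \<in> measurable (PiM {0..<t} (\<lambda>_. count_space UNIV))
          (subprob_algebra (count_space UNIV))"
  proof (cases t)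
    case 0
    then show ?thesis
      by (simp add: chain_step_def[abs_def] measure_pmf_in_subprob_algebra)
  next
    case (Suc s)
    have "(\<lambda>\<omega>. measure_pmf (K (\<omega> s))) \<in> measurable (PiM {0..<t} (\<lambda>_. count_space UNIV))
          (subprob_algebra (count_space UNIV))"
    proof (rule measurable_compose[where N="count_space UNIV" and f="\<lambda>\<omega>. \<omega> s"
          and g="\<lambda>y. measure_pmf (K y)"])
      show "(\<lambda>\<omega>. \<omega> s) \<in> measurable (PiM {0..<t} (\<lambda>_. count_space UNIV)) (count_space UNIV)"
        by (rule measurable_component_singleton) (simp add: Suc)
    qed (simp add: measure_pmf_in_subprob_algebra)
    then show ?thesis
      by (simp add: chain_step_def[abs_def] Suc)
  qed
qed (simp add: chain_step_def prob_space_measure_pmf)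

lemma sets_markov_chain [measurable_cong, simp]:
  "sets (markov_chain K x) = sets (PiM UNIV (\<lambda>_. count_space UNIV))"
proof -
  interpret Ionescu_Tulcea "chain_step K x" "\<lambda>_. count_space UNIV"
    by (rule Ionescu_Tulcea_chain_step)
  show ?thesis by (simp add: markov_chain_def)
qed

lemma space_markov_chain [simp]: "space (markov_chain K x) = UNIV"
  by (simp add: sets_eq_imp_space_eq[OF sets_markov_chain] space_PiM PiE_UNIV_domain)

lemma prob_space_markov_chain: "prob_space (markov_chain K x)"
proof -
  interpret Ionescu_Tulcea "chain_step K x" "\<lambda>_. count_space UNIV"
    by (rule Ionescu_Tulcea_chain_step)
  have "emeasure PF.lim (PF.emb UNIV {} {\<lambda>_. undefined}) = emeasure (CI {}) {\<lambda>_. undefined}"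
    by (rule lim) (auto simp: PiM_empty)
  moreover have "PF.emb UNIV {} {\<lambda>_. undefined} = UNIV"
    by (auto simp: prod_emb_def space_PiM restrict_def)
  moreover have "emeasure (CI {}) {\<lambda>_. undefined} = 1"
    using prob_space.emeasure_space_1[OF PF.prob_space_P[of "{}"]]
    by (simp add: PF.space_P space_PiM)
  ultimately show ?thesis
    by (intro prob_spaceI) (simp add: markov_chain_def space_PiM PiE_UNIV_domain)
qed

lemma measure_markov_chain_path:
  "measure (markov_chain K x) {\<omega>. \<forall>s\<le>t. \<omega> s = y s} =
     (if y 0 = x then \<Prod>s<t. pmf (K (y s)) (y (Suc s)) else 0)"
proof -
  interpret Ionescu_Tulcea "chain_step K x" "\<lambda>_. count_space UNIV"
    by (rule Ionescu_Tulcea_chain_step)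
  define r where "r n = restrict y {0..<n}" for n
  have r_space: "r n \<in> space (PiM {0..<n} (\<lambda>_. count_space UNIV))" for n
    by (auto simp: r_def space_PiM)
  have r_sets [measurable]: "{r n} \<in> sets (PiM {0..<n} (\<lambda>_. count_space UNIV))" for n
  proof -
    have "{r n} = (\<Pi>\<^sub>E i\<in>{0..<n}. {y i})"
      by (auto simp: r_def PiE_iff extensional_def fun_eq_iff)
    then show ?thesis by (auto intro!: sets_PiM_I_finite)
  qed
  have C_step: "emeasure (C 0 (Suc n) (\<lambda>_. undefined)) {r (Suc n)} =
      emeasure (C 0 n (\<lambda>_. undefined)) {r n} * emeasure (chain_step K x n (r n)) {y n}" for n
  proof -
    have u: "(\<lambda>_. undefined) \<in> space (PiM {0..<0} (\<lambda>_. count_space UNIV))"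
      by (simp add: space_PiM PiE_iff extensional_def)
    have ne: "space (C 0 n (\<lambda>_. undefined)) \<noteq> {}"
      using r_space[of n] u by (auto simp: space_C)
    have "emeasure (C 0 (Suc n) (\<lambda>_. undefined)) {r (Suc n)} =
        (\<integral>\<^sup>+\<omega>. emeasure (eP n \<omega>) {r (Suc n)} \<partial>C 0 n (\<lambda>_. undefined))"
      using ne u by (simp add: emeasure_bind[where N="PiM {0..<Suc n} (\<lambda>_. count_space UNIV)"]
          measurable_cong_sets[OF sets_C refl])
    also have "\<dots> = (\<integral>\<^sup>+\<omega>. emeasure (chain_step K x n (r n)) {y n} * indicator {r n} \<omega>
        \<partial>C 0 n (\<lambda>_. undefined))"
    proof (rule nn_integral_cong)
      fix \<omega> assume "\<omega> \<in> space (C 0 n (\<lambda>_. undefined))"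
      then have w: "\<omega> \<in> space (PiM {0..<n} (\<lambda>_. count_space UNIV))"
        using u by (simp add: space_C)
      then have ext: "\<omega> \<in> extensional {0..<n}"
        by (auto simp: space_PiM PiE_def)
      have "fun_upd \<omega> n z = r (Suc n) \<longleftrightarrow> \<omega> = r n \<and> z = y n" for z
      proof
        assume eq: "fun_upd \<omega> n z = r (Suc n)"
        have "\<omega> i = r n i" for i
          using fun_cong[OF eq, of i] ext by (auto simp: r_def extensional_def split: if_splits)
        then show "\<omega> = r n \<and> z = y n"
          using fun_cong[OF eq, of n] by (auto simp: r_def)
      qed (auto simp: r_def fun_eq_iff)
      then have "(\<lambda>z. fun_upd \<omega> n z) -` {r (Suc n)} = (if \<omega> = r n then {y n} else {})"
        by auto
      then show "emeasure (eP n \<omega>) {r (Suc n)} =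
          emeasure (chain_step K x n (r n)) {y n} * indicator {r n} \<omega>"
        using w by (subst emeasure_eP) (auto simp: indicator_def)
    qed
    also have "\<dots> = emeasure (C 0 n (\<lambda>_. undefined)) {r n} * emeasure (chain_step K x n (r n)) {y n}"
      using u by (subst nn_integral_cmult_indicator) (auto simp: sets_C mult.commute)
    finally show ?thesis .
  qed
  have "emeasure (C 0 (Suc t) (\<lambda>_. undefined)) {r (Suc t)} =
      ennreal (if y 0 = x then \<Prod>s<t. pmf (K (y s)) (y (Suc s)) else 0)"
  proof (induction t)
    case 0
    have "emeasure (C 0 0 (\<lambda>_. undefined)) {r 0} = 1"
      by (simp add: r_def restrict_def space_PiM emeasure_return PiM_empty)
    then show ?case
      unfolding C_step[of 0] by (auto simp: chain_step_def emeasure_pmf_single)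
  next
    case (Suc t)
    have "chain_step K x (Suc t) (r (Suc t)) = measure_pmf (K (y t))"
      by (simp add: chain_step_def r_def)
    then show ?case
      unfolding C_step[of "Suc t"] Suc.IH
      by (simp add: emeasure_pmf_single flip: ennreal_mult' ennreal_mult'')
  qed
  moreover have "emeasure (markov_chain K x) {\<omega>. \<forall>s\<le>t. \<omega> s = y s} =
      emeasure (C 0 (Suc t) (\<lambda>_. undefined)) {r (Suc t)}"
  proof -
    have "{\<omega>. \<forall>s\<le>t. \<omega> s = y s} = PF.emb UNIV {0..<Suc t} {r (Suc t)}"
      by (auto simp: prod_emb_def space_PiM r_def fun_eq_iff restrict_def) (metis less_Suc_eq_le)
    moreover have "PF.emb {0..<Suc t} {0..<Suc t} {r (Suc t)} = {r (Suc t)}"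
      by (auto simp: prod_emb_def space_PiM r_def restrict_def fun_eq_iff PiE_iff extensional_def)
        (metis (full_types))
    ultimately show ?thesis
      using lim[of "{0..<Suc t}" "{r (Suc t)}"] emeasure_CI[of "{0..<Suc t}" "Suc t" "{r (Suc t)}"]
      by (simp add: markov_chain_def del: C.simps)
  qed
  ultimately show ?thesis
    by (simp add: measure_def prod_nonneg)
qed


section \<open>Simulated tempering\<close>

text \<open>
  A state is a pair of a clique and a temperature index; \<open>\<beta> i\<close> is the \<open>i\<close>-th inverse temperature
  and \<open>Z (\<beta> i)\<close> the estimate of the partition function there.
\<close>

definition st_states :: "nat \<Rightarrow> nat set set \<Rightarrow> nat \<Rightarrow> (nat set \<times> nat) set" where
  "st_states n E m = cliques n E \<times> {1..m}"

definition st_move ::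
  "nat \<Rightarrow> nat set set \<Rightarrow> (nat \<Rightarrow> real) \<Rightarrow> nat \<Rightarrow> (nat \<Rightarrow> real) \<Rightarrow> (real \<Rightarrow> real) \<Rightarrow> real \<Rightarrow>
     nat set \<times> nat \<Rightarrow> nat set \<times> nat \<Rightarrow> real" where
  "st_move n E h m \<beta> Z a = (\<lambda>(C, i) (C', i').
     if (C, i) \<notin> st_states n E m \<or> (C', i') \<notin> st_states n E m then 0
     else if i = i' \<and> card (sym_diff C C') = 1 then
       a / real n * min 1 (exp (\<beta> i * (h (card C') - h (card C))))
     else if C = C' \<and> (i' = i + 1 \<or> i = i' + 1) then
       (1 - a) / 2 * min 1 (Z (\<beta> i) / Z (\<beta> i') * exp ((\<beta> i' - \<beta> i) * h (card C)))
     else 0)"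

text \<open>Pairs outside the state space are made absorbing; they are never reached from inside it.\<close>

definition st_trans ::
  "nat \<Rightarrow> nat set set \<Rightarrow> (nat \<Rightarrow> real) \<Rightarrow> nat \<Rightarrow> (nat \<Rightarrow> real) \<Rightarrow> (real \<Rightarrow> real) \<Rightarrow> real \<Rightarrow>
     nat set \<times> nat \<Rightarrow> nat set \<times> nat \<Rightarrow> real" where
  "st_trans n E h m \<beta> Z a x y =
     (if y = x then 1 - (\<Sum>z\<in>st_states n E m - {x}. st_move n E h m \<beta> Z a x z)
      else st_move n E h m \<beta> Z a x y)"

definition st_kernel ::
  "nat \<Rightarrow> nat set set \<Rightarrow> (nat \<Rightarrow> real) \<Rightarrow> nat \<Rightarrow> (nat \<Rightarrow> real) \<Rightarrow> (real \<Rightarrow> real) \<Rightarrow> real \<Rightarrow>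
     nat set \<times> nat \<Rightarrow> (nat set \<times> nat) pmf" where
  "st_kernel n E h m \<beta> Z a x = embed_pmf (st_trans n E h m \<beta> Z a x)"

definition st_dynamics ::
  "nat \<Rightarrow> nat set set \<Rightarrow> (nat \<Rightarrow> real) \<Rightarrow> nat \<Rightarrow> (nat \<Rightarrow> real) \<Rightarrow> (real \<Rightarrow> real) \<Rightarrow> real \<Rightarrow>
     nat set \<times> nat \<Rightarrow> (nat \<Rightarrow> nat set \<times> nat) measure" where
  "st_dynamics n E h m \<beta> Z a x = markov_chain (st_kernel n E h m \<beta> Z a) x"

definition st_params :: "nat \<Rightarrow> (nat \<Rightarrow> real) \<Rightarrow> (real \<Rightarrow> real) \<Rightarrow> real \<Rightarrow> bool" where
  "st_params m \<beta> Z a \<longleftrightarrow>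
     1 \<le> m \<and> strict_mono_on {1..m} \<beta> \<and> (\<forall>i\<in>{1..m}. 0 < Z (\<beta> i)) \<and> 0 < a \<and> a < 1"

lemma finite_st_states: "finite (st_states n E m)"
  by (auto simp: st_states_def cliques_def intro: finite_subset[of _ "Pow {..<n}"])

lemma st_move_nonneg: "st_params m \<beta> Z a \<Longrightarrow> 0 \<le> st_move n E h m \<beta> Z a x y"
  by (auto simp: st_move_def st_params_def st_states_def split: prod.splits intro!: mult_nonneg_nonneg)
     (auto intro!: divide_nonneg_pos less_imp_le)

lemma sum_st_move_le:
  assumes "st_params m \<beta> Z a"
  shows "(\<Sum>z\<in>st_states n E m - {x}. st_move n E h m \<beta> Z a x z) \<le> 1"
proof (cases "x \<in> st_states n E m")
  case False
  then have "st_move n E h m \<beta> Z a x z = 0" for z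
    by (cases x; cases z) (simp add: st_move_def)
  then show ?thesis by simp
next
  case True
  obtain C i where x: "x = (C, i)" by (cases x)
  have a: "0 < a" "a < 1" using assms by (auto simp: st_params_def)
  have C: "C \<subseteq> {..<n}" using True by (simp add: x st_states_def cliques_def)
  define L where "L = (\<lambda>v. (sym_diff C {v}, i)) ` {..<n}"
  define T where "T = {(C, i + 1), (C, i - 1)}"
  have le: "st_move n E h m \<beta> Z a x z \<le>
      (if z \<in> L then a / real n else 0) + (if z \<in> T then (1 - a) / 2 else 0)"
    if "z \<in> st_states n E m" for z
  proof -
    obtain C' i' where z: "z = (C', i')" by (cases z)
    have C': "C' \<subseteq> {..<n}" using that by (simp add: z st_states_def cliques_def)
    consider (1) "i = i'" "card (sym_diff C C') = 1"
      | (2) "\<not> (i = i' \<and> card (sym_diff C C') = 1)" "C = C'" "i' = i + 1 \<or> i = i' + 1"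
      | (3) "st_move n E h m \<beta> Z a x z = 0"
    proof -
      have "st_move n E h m \<beta> Z a x z = 0"
        if "\<not> (i = i' \<and> card (sym_diff C C') = 1)" "\<not> (C = C' \<and> (i' = i + 1 \<or> i = i' + 1))"
        unfolding st_move_def x z prod.case if_not_P[OF that(1)] if_not_P[OF that(2)] by (rule if_cancel)
      then show thesis using that by blast
    qed
    then show ?thesis
    proof cases
      case 1
      then obtain v where v: "sym_diff C C' = {v}" by (auto simp: card_1_singleton_iff)
      then have "v < n" using C C' by auto
      moreover have "C' = sym_diff C {v}" using v by blast
      ultimately have "z \<in> L" using 1 by (auto simp: L_def z)
      moreover have "st_move n E h m \<beta> Z a x z \<le> a / real n"
        using 1 a True that by (auto simp: st_move_def x z intro!: divide_right_mono mult_left_le)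
      ultimately show ?thesis using a by (auto intro: add_increasing2)
    next
      case 2
      then have "z \<in> T" by (auto simp: T_def z)
      moreover have "st_move n E h m \<beta> Z a x z \<le> (1 - a) / 2 * 1"
        using 2 a True that unfolding st_move_def x z
        by (auto intro!: mult_left_mono simp del: mult_1_right)
      ultimately have "0 + st_move n E h m \<beta> Z a x z \<le>
          (if z \<in> L then a / real n else 0) + (if z \<in> T then (1 - a) / 2 else 0)"
        using a by (intro add_mono) auto
      then show ?thesis by simp
    next
      case 3
      then show ?thesis using a by simp
    qed
  qed
  have fin: "finite (st_states n E m - {x})" using finite_st_states by blast
  have "(\<Sum>z\<in>st_states n E m - {x}. st_move n E h m \<beta> Z a x z) \<le>
      (\<Sum>z\<in>st_states n E m - {x}.
        (if z \<in> L then a / real n else 0) + (if z \<in> T then (1 - a) / 2 else 0))"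
    by (intro sum_mono le) auto
  also have "\<dots> = real (card ((st_states n E m - {x}) \<inter> L)) * (a / real n) +
      real (card ((st_states n E m - {x}) \<inter> T)) * ((1 - a) / 2)"
    using fin by (simp add: sum.distrib sum.If_cases Int_def)
  also have "\<dots> \<le> real n * (a / real n) + 2 * ((1 - a) / 2)"
  proof (intro add_mono mult_right_mono)
    have "card ((st_states n E m - {x}) \<inter> L) \<le> card L"
      by (intro card_mono) (auto simp: L_def)
    also have "\<dots> \<le> n" unfolding L_def using card_image_le[of "{..<n}"] by fastforce
    finally show "real (card ((st_states n E m - {x}) \<inter> L)) \<le> real n" by simp
    have "card ((st_states n E m - {x}) \<inter> T) \<le> card T"
      by (intro card_mono) (auto simp: T_def)
    also have "\<dots> \<le> 2" by (simp add: T_def card_insert_if)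
    finally show "real (card ((st_states n E m - {x}) \<inter> T)) \<le> 2" by simp
  qed (use a in auto)
  also have "\<dots> \<le> 1" using a by (cases "n = 0") (auto simp: field_simps)
  finally show ?thesis .
qed

lemma pmf_st_kernel:
  assumes "st_params m \<beta> Z a"
  shows "pmf (st_kernel n E h m \<beta> Z a x) y = st_trans n E h m \<beta> Z a x y"
  unfolding st_kernel_def
proof (rule pmf_embed_pmf)
  show nonneg: "0 \<le> st_trans n E h m \<beta> Z a x y" for y
    using sum_st_move_le[OF assms] st_move_nonneg[OF assms] by (simp add: st_trans_def)
  let ?A = "insert x (st_states n E m)"
  have out: "st_trans n E h m \<beta> Z a x y = 0" if "y \<notin> ?A" for y
    using that by (auto simp: st_trans_def st_move_def split: prod.splits)
  have fin: "finite ?A" using finite_st_states by auto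
  have "(\<integral>\<^sup>+y. ennreal (st_trans n E h m \<beta> Z a x y) \<partial>count_space UNIV) =
      (\<Sum>y\<in>?A. ennreal (st_trans n E h m \<beta> Z a x y))"
    by (rule nn_integral_count_space'[OF fin]) (auto simp: out nonneg)
  also have "\<dots> = ennreal (\<Sum>y\<in>?A. st_trans n E h m \<beta> Z a x y)"
    by (intro sum_ennreal nonneg)
  also have "(\<Sum>y\<in>?A. st_trans n E h m \<beta> Z a x y) =
      st_trans n E h m \<beta> Z a x x + (\<Sum>y\<in>st_states n E m - {x}. st_trans n E h m \<beta> Z a x y)"
    by (rule sum.insert_remove[OF finite_st_states])
  also have "(\<Sum>y\<in>st_states n E m - {x}. st_trans n E h m \<beta> Z a x y) =
      (\<Sum>y\<in>st_states n E m - {x}. st_move n E h m \<beta> Z a x y)"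
    by (rule sum.cong) (auto simp: st_trans_def)
  finally show "(\<integral>\<^sup>+y. ennreal (st_trans n E h m \<beta> Z a x y) \<partial>count_space UNIV) = 1"
    by (simp add: st_trans_def)
qed

end

theory Submission
  imports Defs "HOL-Real_Asymp.Real_Asymp"
begin

text \<open>
  The chain is reversible with respect to \<open>w (C, i) = exp (\<beta>\<^sub>i h(|C|)) / Z(\<beta>\<^sub>i)\<close>, a weight that
  sees the clique only through its size, and a single step changes \<open>|C \<inter> PC|\<close> by at most one. Hence
  a chain started with \<open>|C \<inter> PC| = 0\<close> must visit the bottleneck \<open>|C \<inter> PC| = r\<close> with
  \<open>r \<approx> \<rho> log n\<close>, and its relative weight is at most the largest ratio, over the sizes \<open>q\<close>,
  between the numbers of \<open>q\<close>-cliques of overlap \<open>r\<close> and of overlap \<open>0\<close>, whatever \<open>h\<close>, \<open>\<beta>\<close> and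
  \<open>Z\<close> are. For \<open>\<rho>\<close> small this ratio is \<open>exp (- \<Omega>(log\<^sup>2 n))\<close> with high probability: the first moment
  bounds the cliques of overlap \<open>r\<close> and the second moment gives the cliques of overlap \<open>0\<close> up to size
  \<open>(2 - \<epsilon>) log n\<close>, beyond which there are no cliques of overlap \<open>r\<close> at all.
\<close>


section \<open>Markov chains on a finite closed set\<close>

text \<open>One graph event has to serve all \<open>h\<close>, \<beta> and \<open>Z\<close> at once.
  The event \<open>good\<close> of the final proof therefore compares clique counts size by size,
  for every \<open>q\<close>, and no union over parameters is taken. The price is that the slow
  start is only shown to exist: it comes from averaging over the states of overlap 0 and may depend
  on the parameters.

  The small factor arises by trading \<open>r\<close> outside vertices of a \<open>q\<close>-clique
  for \<open>r\<close> planted ones. This multiplies the expected count by about (k q / n)^r and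
  makes r(r-1)/2 edges free, a factor of at most 2^(r*r/2). For r at most \<rho> log n with \<rho>
  \<le> (1-\<alpha>)/2, the free edges give back at most n^((1-\<alpha>)/4) per traded vertex, while
  k/n is about n^(\<alpha>-1). So each of the \<open>r\<close> vertices still gains a negative power
  of n, and r of order log n turns this into exp(-const log^2 n). The other constraint, \<rho> <
  \<gamma>, keeps the bottleneck strictly below the target overlap.\<close>

lemma measurable_markov_chain_component [measurable]:
  "(\<lambda>\<omega>. \<omega> i) \<in> markov_chain K x \<rightarrow>\<^sub>M count_space UNIV"
  by (subst measurable_cong_sets[OF sets_markov_chain refl]) (rule measurable_component_singleton, simp)

lemma pred_markov_chain_component [measurable]:
  "Measurable.pred (markov_chain K x) (\<lambda>\<omega>. P (\<omega> i))"
  by (rule measurable_compose[OF measurable_markov_chain_component]) simp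

lemma in_sets_markov_chain:
  "Measurable.pred (markov_chain K x) P \<Longrightarrow> {\<omega>. P \<omega>} \<in> sets (markov_chain K x)"
  using pred_sets1[of "markov_chain K x" P] by (simp add: pred_def)

text \<open>Paths confined to the finite set \<open>S\<close> up to time \<open>s\<close> form
  finitely many disjoint cylinders, and \<open>measure_markov_chain_path\<close> gives the mass of
  each. This yields the Markov property without conditional expectations, which is why the
  confinement clause is carried through the one-time laws below.\<close>

lemma measure_markov_chain_step:
  assumes S: "finite S"
  shows "measure (markov_chain K x) {\<omega>. (\<forall>i\<le>s. \<omega> i \<in> S) \<and> \<omega> s = z \<and> \<omega> (Suc s) = y} =
    measure (markov_chain K x) {\<omega>. (\<forall>i\<le>s. \<omega> i \<in> S) \<and> \<omega> s = z} * pmf (K z) y"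
proof -
  interpret prob_space "markov_chain K x" by (rule prob_space_markov_chain)
  \<comment> \<open>\<open>P\<close> lists the confined histories as extensional functions, so that
    it is finite; \<open>c p\<close> is the cylinder over \<open>p\<close>, and \<open>d p\<close>
    the cylinder over \<open>p\<close> followed by \<open>y\<close>.\<close>
  define P where "P = {p \<in> {..s} \<rightarrow>\<^sub>E S. p s = z}"
  have fin: "finite P" unfolding P_def using S by (auto intro!: finite_PiE)
  define c where "c p = {\<omega>. \<forall>i\<le>s. \<omega> i = p i}" for p :: "nat \<Rightarrow> 'a"
  define d where "d p = {\<omega>. \<forall>i\<le>Suc s. \<omega> i = (p(Suc s := y)) i}" for p :: "nat \<Rightarrow> 'a"
  have c_sets: "c p \<in> sets (markov_chain K x)" for p
    unfolding c_def by (rule in_sets_markov_chain) measurable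
  have d_sets: "d p \<in> sets (markov_chain K x)" for p
    unfolding d_def by (rule in_sets_markov_chain) measurable
  have eq_path: "p = p'" if "p \<in> P" "p' \<in> P" "\<omega> \<in> c p" "\<omega> \<in> c p'" for p p' \<omega>
    using that by (auto simp: P_def c_def PiE_iff extensional_def fun_eq_iff)
      (metis atMost_iff)
  have d_c: "d p \<subseteq> c p" for p
    by (auto simp: d_def c_def)
  have disj_c: "disjoint_family_on c P" and disj_d: "disjoint_family_on d P"
    using eq_path d_c unfolding disjoint_family_on_def by blast+
  have ex: "\<exists>p\<in>P. \<omega> \<in> c p" if "\<forall>i\<le>s. \<omega> i \<in> S" "\<omega> s = z" for \<omega>
    using that by (intro bexI[of _ "restrict \<omega> {..s}"]) (auto simp: P_def c_def)
  have Un_c: "{\<omega>. (\<forall>i\<le>s. \<omega> i \<in> S) \<and> \<omega> s = z} = (\<Union>p\<in>P. c p)"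
    using ex by (auto simp: P_def c_def)
  have "d p = c p \<inter> {\<omega>. \<omega> (Suc s) = y}" for p
    by (auto simp: d_def c_def le_Suc_eq)
  then have Un_d: "{\<omega>. (\<forall>i\<le>s. \<omega> i \<in> S) \<and> \<omega> s = z \<and> \<omega> (Suc s) = y} = (\<Union>p\<in>P. d p)"
    using Un_c by blast
  have step: "measure (markov_chain K x) (d p) = measure (markov_chain K x) (c p) * pmf (K z) y"
    if "p \<in> P" for p
  proof -
    have "(\<Prod>i<s. pmf (K ((p(Suc s := y)) i)) ((p(Suc s := y)) (Suc i))) =
        (\<Prod>i<s. pmf (K (p i)) (p (Suc i)))"
      by (rule prod.cong) auto
    then show ?thesis
      using that unfolding c_def d_def measure_markov_chain_path by (simp add: P_def)
  qed
  show ?thesis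
    unfolding Un_c Un_d
    by (subst (1 2) finite_measure_finite_Union)
      (use fin c_sets d_sets disj_c disj_d step in \<open>auto simp: sum_distrib_right\<close>)
qed

lemma measure_markov_chain_Suc:
  assumes S: "finite S" and y: "y \<in> S"
  shows "measure (markov_chain K x) {\<omega>. (\<forall>i\<le>Suc s. \<omega> i \<in> S) \<and> \<omega> (Suc s) = y} =
    (\<Sum>z\<in>S. measure (markov_chain K x) {\<omega>. (\<forall>i\<le>s. \<omega> i \<in> S) \<and> \<omega> s = z} * pmf (K z) y)"
proof -
  interpret prob_space "markov_chain K x" by (rule prob_space_markov_chain)
  have "{\<omega>. (\<forall>i\<le>Suc s. \<omega> i \<in> S) \<and> \<omega> (Suc s) = y} =
      (\<Union>z\<in>S. {\<omega>. (\<forall>i\<le>s. \<omega> i \<in> S) \<and> \<omega> s = z \<and> \<omega> (Suc s) = y})"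
    using y by (auto simp: le_Suc_eq)
  then show ?thesis
    using S
    by (simp only: measure_markov_chain_step[OF S, symmetric])
      (rule finite_measure_finite_Union,
        auto simp: disjoint_family_on_def simp del: sets_markov_chain intro!: in_sets_markov_chain)
qed

lemma measure_markov_chain_0:
  "measure (markov_chain K x) {\<omega>. (\<forall>i\<le>0. \<omega> i \<in> S) \<and> \<omega> 0 = y} = (if y = x \<and> x \<in> S then 1 else 0)"
proof -
  have "{\<omega>. (\<forall>i\<le>0::nat. \<omega> i \<in> S) \<and> \<omega> 0 = y} = (if y \<in> S then {\<omega>. \<forall>i\<le>0. \<omega> i = y} else {})"
    by auto
  then show ?thesis
    using measure_markov_chain_path[of K x 0 "\<lambda>_. y"] by auto
qed

text \<open>No mass leaks, because the kernel rows indexed by \<open>S\<close> sum to one over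
  \<open>S\<close>. This is what removes the confinement clause almost surely in
  \<open>AE_markov_chain_in\<close>.\<close>

lemma sum_measure_markov_chain:
  assumes S: "finite S" and closed: "\<And>z. z \<in> S \<Longrightarrow> set_pmf (K z) \<subseteq> S" and x: "x \<in> S"
  shows "(\<Sum>y\<in>S. measure (markov_chain K x) {\<omega>. (\<forall>i\<le>s. \<omega> i \<in> S) \<and> \<omega> s = y}) = 1"
proof (induction s)
  case 0
  have "(\<Sum>y\<in>S. if y = x \<and> x \<in> S then 1 else 0 :: real) = (\<Sum>y\<in>S. if y = x then 1 else 0)"
    using x by simp
  with S x show ?case by (simp only: measure_markov_chain_0 sum.delta) simp
next
  case (Suc s)
  let ?q = "\<lambda>s y. measure (markov_chain K x) {\<omega>. (\<forall>i\<le>s. \<omega> i \<in> S) \<and> \<omega> s = y}"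
  have "(\<Sum>y\<in>S. ?q (Suc s) y) = (\<Sum>y\<in>S. \<Sum>z\<in>S. ?q s z * pmf (K z) y)"
    by (rule sum.cong) (auto simp only: measure_markov_chain_Suc[OF S])
  also have "\<dots> = (\<Sum>z\<in>S. ?q s z * (\<Sum>y\<in>S. pmf (K z) y))"
    by (subst sum.swap) (simp only: sum_distrib_left)
  also have "\<dots> = (\<Sum>z\<in>S. ?q s z)"
    using sum_pmf_eq_1[OF S closed] by (intro sum.cong) auto
  finally show ?case using Suc by simp
qed

lemma AE_markov_chain_in:
  assumes S: "finite S" and closed: "\<And>z. z \<in> S \<Longrightarrow> set_pmf (K z) \<subseteq> S" and x: "x \<in> S"
  shows "AE \<omega> in markov_chain K x. \<forall>s. \<omega> s \<in> S"
proof -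
  interpret prob_space "markov_chain K x" by (rule prob_space_markov_chain)
  have "AE \<omega> in markov_chain K x. \<omega> s \<in> S" for s
  proof -
    have m: "{\<omega>. \<forall>i\<le>s. \<omega> i \<in> S} \<in> events"
      by (rule in_sets_markov_chain) measurable
    have "{\<omega>. \<forall>i\<le>s. \<omega> i \<in> S} = (\<Union>y\<in>S. {\<omega>. (\<forall>i\<le>s. \<omega> i \<in> S) \<and> \<omega> s = y})" by auto
    then have "prob {\<omega>. \<forall>i\<le>s. \<omega> i \<in> S} =
        (\<Sum>y\<in>S. prob {\<omega>. (\<forall>i\<le>s. \<omega> i \<in> S) \<and> \<omega> s = y})"
      using S by simp (rule finite_measure_finite_Union,
        auto simp: disjoint_family_on_def simp del: sets_markov_chain intro!: in_sets_markov_chain)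
    then have "prob {\<omega>. \<forall>i\<le>s. \<omega> i \<in> S} = 1"
      using sum_measure_markov_chain[OF assms] by simp
    then have "AE \<omega> in markov_chain K x. \<omega> \<in> {\<omega>. \<forall>i\<le>s. \<omega> i \<in> S}"
      using prob_eq_1[OF m] by simp
    then show ?thesis by eventually_elim auto
  qed
  then show ?thesis by (simp add: AE_all_countable)
qed

lemma AE_markov_chain_0: "AE \<omega> in markov_chain K x. \<omega> 0 = x"
proof -
  interpret prob_space "markov_chain K x" by (rule prob_space_markov_chain)
  have "prob {\<omega>. \<omega> 0 = x} = 1"
    using measure_markov_chain_0[of K x UNIV x] by simp
  moreover have "{\<omega>. \<omega> 0 = x} \<in> events" by (rule in_sets_markov_chain) measurable
  ultimately have "AE \<omega> in markov_chain K x. \<omega> \<in> {\<omega>. \<omega> 0 = x}"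
    using prob_eq_1 by blast
  then show ?thesis by simp
qed

text \<open>Inside \<open>S\<close> only finitely many pairs have transition probability zero, so at
  each time their union is null. The lemma transfers facts about the support of the kernel to whole
  trajectories.\<close>

lemma AE_markov_chain_step:
  assumes S: "finite S" and closed: "\<And>z. z \<in> S \<Longrightarrow> set_pmf (K z) \<subseteq> S" and x: "x \<in> S"
  shows "AE \<omega> in markov_chain K x. \<forall>s. \<omega> (Suc s) \<in> set_pmf (K (\<omega> s))"
proof -
  interpret prob_space "markov_chain K x" by (rule prob_space_markov_chain)
  have "AE \<omega> in markov_chain K x. \<omega> (Suc s) \<in> set_pmf (K (\<omega> s))" for s
  proof -
    have null: "AE \<omega> in markov_chain K x.
        \<not> ((\<forall>i\<le>s. \<omega> i \<in> S) \<and> \<omega> s = z \<and> \<omega> (Suc s) = y)"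
      if "y \<notin> set_pmf (K z)" for y z
    proof -
      have m: "{\<omega>. (\<forall>i\<le>s. \<omega> i \<in> S) \<and> \<omega> s = z \<and> \<omega> (Suc s) = y} \<in> events"
        by (rule in_sets_markov_chain) measurable
      have "pmf (K z) y = 0" using that by (simp add: set_pmf_iff)
      then have "prob {\<omega>. (\<forall>i\<le>s. \<omega> i \<in> S) \<and> \<omega> s = z \<and> \<omega> (Suc s) = y} = 0"
        by (simp add: measure_markov_chain_step[OF S])
      then have "AE \<omega> in markov_chain K x.
          \<omega> \<notin> {\<omega>. (\<forall>i\<le>s. \<omega> i \<in> S) \<and> \<omega> s = z \<and> \<omega> (Suc s) = y}"
        using prob_eq_0[OF m] by simp
      then show ?thesis by simp
    qed
    have "AE \<omega> in markov_chain K x. \<forall>z\<in>S. \<forall>y\<in>S. y \<notin> set_pmf (K z) \<longrightarrow>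
        \<not> ((\<forall>i\<le>s. \<omega> i \<in> S) \<and> \<omega> s = z \<and> \<omega> (Suc s) = y)"
      using S null by (intro AE_finite_allI AE_impI) auto
    moreover have "AE \<omega> in markov_chain K x. \<forall>s. \<omega> s \<in> S"
      by (rule AE_markov_chain_in[OF S]) (use closed x in auto)
    ultimately show ?thesis
      by eventually_elim auto
  qed
  then show ?thesis by (simp add: AE_all_countable)
qed

text \<open>Induction on time with the forward equation \<open>measure_markov_chain_Suc\<close>. The
  weight is left unnormalised, so true partition functions never enter.\<close>

lemma sum_stationary_markov_chain:
  assumes S: "finite S"
    and stat: "\<And>y. y \<in> S \<Longrightarrow> (\<Sum>x\<in>S. w x * pmf (K x) y) = w y" and y: "y \<in> S"
  shows "(\<Sum>x\<in>S. w x * measure (markov_chain K x) {\<omega>. (\<forall>i\<le>s. \<omega> i \<in> S) \<and> \<omega> s = y}) = w y"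
  using y
proof (induction s arbitrary: y)
  case 0
  have "(\<Sum>x\<in>S. w x * (if y = x \<and> x \<in> S then 1 else 0)) = (\<Sum>x\<in>S. if y = x then w x else 0)"
    by (rule sum.cong) auto
  with S 0 show ?case by (simp only: measure_markov_chain_0 sum.delta') simp
next
  case (Suc s)
  let ?q = "\<lambda>s x y. measure (markov_chain K x) {\<omega>. (\<forall>i\<le>s. \<omega> i \<in> S) \<and> \<omega> s = y}"
  have "(\<Sum>x\<in>S. w x * ?q (Suc s) x y) = (\<Sum>x\<in>S. \<Sum>z\<in>S. w x * ?q s x z * pmf (K z) y)"
    by (simp only: measure_markov_chain_Suc[OF S Suc.prems] sum_distrib_left mult.assoc)
  also have "\<dots> = (\<Sum>z\<in>S. (\<Sum>x\<in>S. w x * ?q s x z) * pmf (K z) y)"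
    by (subst sum.swap) (simp only: sum_distrib_right)
  also have "\<dots> = (\<Sum>z\<in>S. w z * pmf (K z) y)"
    by (rule sum.cong) (simp_all only: Suc.IH)
  finally show ?case using stat[OF Suc.prems] by simp
qed

text \<open>
  Averaging over starts in \<open>A\<close> with weight \<open>w\<close> costs nothing compared with starting from all of
  \<open>w\<close>, and then stationarity bounds the occupation of \<open>B\<close> at each of the \<open>t\<close> times by \<open>sum w B\<close>.
\<close>

lemma exists_slow_start:
  fixes w :: "'s \<Rightarrow> real" and \<delta> :: real
  assumes S: "finite S" and closed: "\<And>z. z \<in> S \<Longrightarrow> set_pmf (K z) \<subseteq> S"
    and stat: "\<And>y. y \<in> S \<Longrightarrow> (\<Sum>x\<in>S. w x * pmf (K x) y) = w y"
    and w: "\<And>y. y \<in> S \<Longrightarrow> 0 < w y"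
    and A: "A \<subseteq> S" "A \<noteq> {}" "A \<subseteq> D" and B: "B \<subseteq> S"
    and BA: "sum w B \<le> \<delta> * sum w A"
    and exit: "\<And>z y. z \<in> S \<inter> D - B \<Longrightarrow> y \<in> set_pmf (K z) \<Longrightarrow> y \<in> D"
  shows "\<exists>x\<in>A. measure (markov_chain K x) {\<omega>. \<exists>s<t. \<omega> s \<notin> D} \<le> real t * \<delta>"
proof -
  let ?q = "\<lambda>s x y. measure (markov_chain K x) {\<omega>. (\<forall>i\<le>s. \<omega> i \<in> S) \<and> \<omega> s = y}"
  let ?p = "\<lambda>x. measure (markov_chain K x) {\<omega>. \<exists>s<t. \<omega> s \<notin> D}"
  have finA: "finite A" and finB: "finite B" using A B S by (auto intro: finite_subset)
  have le: "?p x \<le> (\<Sum>s<t. \<Sum>y\<in>B. ?q s x y)" if x: "x \<in> A" for x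
  proof -
    have xS: "x \<in> S" using x A by auto
    interpret prob_space "markov_chain K x" by (rule prob_space_markov_chain)
    let ?E = "\<lambda>s y. {\<omega>. (\<forall>i\<le>s. \<omega> i \<in> S) \<and> \<omega> s = y}"
    have E: "?E s y \<in> events" for s y by (rule in_sets_markov_chain) measurable
    have inS: "AE \<omega> in markov_chain K x. \<forall>s. \<omega> s \<in> S"
      by (rule AE_markov_chain_in[OF S]) (use closed xS in auto)
    have steps: "AE \<omega> in markov_chain K x. \<forall>s. \<omega> (Suc s) \<in> set_pmf (K (\<omega> s))"
      by (rule AE_markov_chain_step[OF S]) (use closed xS in auto)
    have "AE \<omega> in markov_chain K x. \<omega> \<in> {\<omega>. \<exists>s<t. \<omega> s \<notin> D} \<longrightarrow>
        \<omega> \<in> (\<Union>s<t. \<Union>y\<in>B. ?E s y)"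
      using inS AE_markov_chain_0[where K=K and x=x] steps
    proof eventually_elim
      case (elim \<omega>)
      \<comment> \<open>The path starts in \<open>D\<close> and can leave it only from
        \<open>B\<close>, so being outside \<open>D\<close> at a time before \<open>t\<close> forces
        an earlier visit to \<open>B\<close>.\<close>
      have inD: "\<omega> s \<in> D" if "\<forall>i<s. \<omega> i \<notin> B" for s
        using that
      proof (induction s)
        case 0
        then show ?case using elim(2) x A by auto
      next
        case (Suc s)
        then show ?case using exit[of "\<omega> s" "\<omega> (Suc s)"] elim by auto
      qed
      show ?case
      proof
        assume "\<omega> \<in> {\<omega>. \<exists>s<t. \<omega> s \<notin> D}"
        then obtain s where "s < t" "\<omega> s \<notin> D" by auto
        with inD[of s] obtain i where "i < t" "\<omega> i \<in> B" using order.strict_trans by blast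
        with elim(1) show "\<omega> \<in> (\<Union>s<t. \<Union>y\<in>B. ?E s y)" by auto
      qed
    qed
    then have "?p x \<le> prob (\<Union>s<t. \<Union>y\<in>B. ?E s y)"
      by (rule finite_measure_mono_AE) (use E finB in \<open>auto intro!: sets.finite_UN\<close>)
    also have "\<dots> \<le> (\<Sum>s<t. prob (\<Union>y\<in>B. ?E s y))"
      by (rule finite_measure_subadditive_finite) (use E finB in \<open>auto intro!: sets.finite_UN\<close>)
    also have "\<dots> \<le> (\<Sum>s<t. \<Sum>y\<in>B. prob (?E s y))"
      by (intro sum_mono finite_measure_subadditive_finite) (use E finB in auto)
    finally show ?thesis .
  qed
  have "(\<Sum>x\<in>A. w x * ?p x) \<le> (\<Sum>x\<in>A. w x * (\<Sum>s<t. \<Sum>y\<in>B. ?q s x y))"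
  proof (rule sum_mono)
    fix x assume x: "x \<in> A"
    then have "0 \<le> w x" using A w[of x] by auto
    with le[OF x] show "w x * ?p x \<le> w x * (\<Sum>s<t. \<Sum>y\<in>B. ?q s x y)"
      by (rule mult_left_mono)
  qed
  also have "\<dots> \<le> (\<Sum>x\<in>S. w x * (\<Sum>s<t. \<Sum>y\<in>B. ?q s x y))"
    using A S w by (intro sum_mono2) (auto intro!: mult_nonneg_nonneg sum_nonneg intro: less_imp_le)
  also have "\<dots> = (\<Sum>x\<in>S. \<Sum>s<t. \<Sum>y\<in>B. w x * ?q s x y)"
    by (simp only: sum_distrib_left)
  \<comment> \<open>The sum over starts is moved innermost, where stationarity evaluates it to
    \<open>w y\<close>.\<close>
  also have "\<dots> = (\<Sum>s<t. \<Sum>y\<in>B. \<Sum>x\<in>S. w x * ?q s x y)"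
    by (subst sum.swap) (intro sum.cong refl sum.swap)
  also have "\<dots> = (\<Sum>s<t. sum w B)"
  proof (intro sum.cong refl)
    fix s y assume "y \<in> B"
    then show "(\<Sum>x\<in>S. w x * ?q s x y) = w y"
      using B by (intro sum_stationary_markov_chain[OF S stat]) auto
  qed
  also have "\<dots> \<le> (\<Sum>x\<in>A. w x * (real t * \<delta>))"
    unfolding sum_distrib_right[symmetric]
    using mult_left_mono[OF BA, of "real t"] by (simp add: mult_ac)
  finally have sum_le: "(\<Sum>x\<in>A. w x * ?p x) \<le> (\<Sum>x\<in>A. w x * (real t * \<delta>))" .
  \<comment> \<open>If every start in \<open>A\<close> exceeded the bound, the weighted sum would
    too, since all weights are positive.\<close>
  show ?thesis
  proof (rule ccontr)
    assume "\<not> ?thesis"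
    then have "(\<Sum>x\<in>A. w x * (real t * \<delta>)) < (\<Sum>x\<in>A. w x * ?p x)"
      using A w finA by (intro sum_strict_mono mult_strict_left_mono) (auto simp: not_le)
    with sum_le show False by simp
  qed
qed


section \<open>The bottleneck of simulated tempering\<close>

definition overlap_cliques :: "nat \<Rightarrow> nat set set \<Rightarrow> nat set \<Rightarrow> nat \<Rightarrow> nat \<Rightarrow> nat set set" where
  "overlap_cliques n E P r q = {C \<in> cliques n E. card C = q \<and> card (C \<inter> P) = r}"

definition st_weight :: "(nat \<Rightarrow> real) \<Rightarrow> (nat \<Rightarrow> real) \<Rightarrow> (real \<Rightarrow> real) \<Rightarrow> nat set \<times> nat \<Rightarrow> real" where
  "st_weight h \<beta> Z = (\<lambda>(C, i). exp (\<beta> i * h (card C)) / Z (\<beta> i))"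

lemma finite_cliques: "finite (cliques n E)"
  by (auto simp: cliques_def intro: finite_subset[of _ "Pow {..<n}"])

lemma finite_overlap_cliques: "finite (overlap_cliques n E P r q)"
  unfolding overlap_cliques_def using finite_cliques by auto

lemma st_weight_pos: "st_params m \<beta> Z a \<Longrightarrow> x \<in> st_states n E m \<Longrightarrow> 0 < st_weight h \<beta> Z x"
  by (auto simp: st_params_def st_states_def st_weight_def intro!: divide_pos_pos)

text \<open>Both kinds of move are Metropolis moves: weight times rate equals a symmetric factor
  times the minimum of the two weights. The temperature acceptance contains the same
  \<open>Z\<close> as the weight, so balance is exact however poor the estimates are.\<close>

lemma st_detailed_balance:
  assumes "st_params m \<beta> Z a"
  shows "st_weight h \<beta> Z x * st_move n E h m \<beta> Z a x y =
    st_weight h \<beta> Z y * st_move n E h m \<beta> Z a y x"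
proof -
  obtain C i where x: "x = (C, i)" by (cases x)
  obtain C' i' where y: "y = (C', i')" by (cases y)
  show ?thesis
  proof (cases "x \<in> st_states n E m \<and> y \<in> st_states n E m")
    case False
    then show ?thesis by (auto simp: st_move_def x y)
  next
    case True
    then have Z: "0 < Z (\<beta> i)" "0 < Z (\<beta> i')"
      using assms by (auto simp: st_params_def st_states_def x y)
    have min_mult: "exp b * min 1 (exp (d - b)) = min (exp b) (exp d)" for b d :: real
      by (simp add: min_mult_distrib_left flip: exp_add)
    have level: "exp (\<beta> i * h (card C)) / Z (\<beta> i) *
        (a / n * min 1 (exp (\<beta> i * (h (card C') - h (card C))))) =
        a / n / Z (\<beta> i) * min (exp (\<beta> i * h (card C))) (exp (\<beta> i * h (card C')))" for C C'
      using min_mult[of "\<beta> i * h (card C)" "\<beta> i * h (card C')"]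
      by (simp add: right_diff_distrib mult_ac divide_simps)
    have temp: "exp (\<beta> i * H) / Z (\<beta> i) *
        ((1 - a) / 2 * min 1 (Z (\<beta> i) / Z (\<beta> i') * exp ((\<beta> i' - \<beta> i) * H))) =
        (1 - a) / 2 * min (exp (\<beta> i * H) / Z (\<beta> i)) (exp (\<beta> i' * H) / Z (\<beta> i'))"
      if "0 < Z (\<beta> i)" "0 < Z (\<beta> i')" for i i' H
    proof -
      have "exp (\<beta> i * H) / Z (\<beta> i) * min 1 (Z (\<beta> i) / Z (\<beta> i') * exp ((\<beta> i' - \<beta> i) * H)) =
        min (exp (\<beta> i * H) / Z (\<beta> i)) (exp (\<beta> i' * H) / Z (\<beta> i'))"
        using that by (simp add: min_mult_distrib_left left_diff_distrib flip: exp_add)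
      then show ?thesis by (simp add: mult_ac)
    qed
    have sym: "sym_diff C' C = sym_diff C C'" by auto
    show ?thesis
    proof (cases "i = i'")
      case True
      then have S: "(C, i) \<in> st_states n E m" "(C', i) \<in> st_states n E m" "i' = i"
        using \<open>x \<in> st_states n E m \<and> y \<in> st_states n E m\<close> by (simp_all add: x y)
      have eq: "exp (\<beta> i * h (card C)) / Z (\<beta> i) *
          (a / n * min 1 (exp (\<beta> i * (h (card C') - h (card C))))) =
          exp (\<beta> i * h (card C')) / Z (\<beta> i) *
          (a / n * min 1 (exp (\<beta> i * (h (card C) - h (card C')))))"
        by (simp only: level min.commute)
      show ?thesis
      proof (cases "card (sym_diff C C') = 1")
        case True
        then have "st_move n E h m \<beta> Z a x y =
            a / n * min 1 (exp (\<beta> i * (h (card C') - h (card C))))"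
          "st_move n E h m \<beta> Z a y x =
            a / n * min 1 (exp (\<beta> i * (h (card C) - h (card C'))))"
          using S by (simp_all add: st_move_def x y sym)
        then show ?thesis
          using eq S by (simp only: st_weight_def x y prod.case)
      next
        case False
        then show ?thesis using S by (simp add: st_move_def x y sym)
      qed
    next
      case False
      show ?thesis
      proof (cases "C = C' \<and> (i' = i + 1 \<or> i = i' + 1)")
        case True
        then have C': "C' = C" by simp
        have eq: "exp (\<beta> i * h (card C)) / Z (\<beta> i) * ((1 - a) / 2 *
            min 1 (Z (\<beta> i) / Z (\<beta> i') * exp ((\<beta> i' - \<beta> i) * h (card C)))) =
            exp (\<beta> i' * h (card C)) / Z (\<beta> i') * ((1 - a) / 2 *
            min 1 (Z (\<beta> i') / Z (\<beta> i) * exp ((\<beta> i - \<beta> i') * h (card C))))"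
          by (simp only: temp Z min.commute)
        have "st_move n E h m \<beta> Z a x y =
            (1 - a) / 2 * min 1 (Z (\<beta> i) / Z (\<beta> i') * exp ((\<beta> i' - \<beta> i) * h (card C)))"
          "st_move n E h m \<beta> Z a y x =
            (1 - a) / 2 * min 1 (Z (\<beta> i') / Z (\<beta> i) * exp ((\<beta> i - \<beta> i') * h (card C)))"
          using True False \<open>x \<in> st_states n E m \<and> y \<in> st_states n E m\<close>
          by (auto simp: st_move_def x y)
        then show ?thesis
          using eq by (simp only: st_weight_def x y prod.case C')
      next
        case no: False
        then show ?thesis using False by (auto simp: st_move_def x y)
      qed
    qed
  qed
qed

lemma sum_st_trans:
  assumes "x \<in> st_states n E m"
  shows "(\<Sum>y\<in>st_states n E m. st_trans n E h m \<beta> Z a x y) = 1"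
proof -
  have "(\<Sum>y\<in>st_states n E m - {x}. st_trans n E h m \<beta> Z a x y) =
      (\<Sum>y\<in>st_states n E m - {x}. st_move n E h m \<beta> Z a x y)"
    by (rule sum.cong) (auto simp: st_trans_def)
  then show ?thesis
    using assms by (simp add: sum.remove[OF finite_st_states assms] st_trans_def[of _ _ _ _ _ _ _ x x])
qed

lemma st_stationary:
  assumes "st_params m \<beta> Z a" and y: "y \<in> st_states n E m"
  shows "(\<Sum>x\<in>st_states n E m. st_weight h \<beta> Z x * pmf (st_kernel n E h m \<beta> Z a x) y) =
    st_weight h \<beta> Z y"
proof -
  have "st_weight h \<beta> Z x * st_trans n E h m \<beta> Z a x y =
      st_weight h \<beta> Z y * st_trans n E h m \<beta> Z a y x" for x
    using st_detailed_balance[OF assms(1)] by (auto simp: st_trans_def)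
  then show ?thesis
    by (simp add: pmf_st_kernel[OF assms(1)] sum_st_trans[OF y] flip: sum_distrib_left)
qed

text \<open>Besides stationarity, this is all that the bottleneck argument uses of the dynamics: the
  state space is closed, and a step alters at most one vertex.\<close>

lemma set_pmf_st_kernel:
  assumes "st_params m \<beta> Z a" and x: "(C, i) \<in> st_states n E m"
    and y: "(C', i') \<in> set_pmf (st_kernel n E h m \<beta> Z a (C, i))"
  shows "(C', i') \<in> st_states n E m" and "C' = C \<or> card (sym_diff C C') = 1"
  using x y by (auto simp: set_pmf_iff pmf_st_kernel[OF assms(1)] st_trans_def st_move_def
      split: if_splits)

text \<open>The weight is constant on states of equal clique size and temperature. After grouping,
  the overlap \<open>r\<close> survives only in the clique counts, with coefficients common to all
  \<open>r\<close>.\<close>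

lemma sum_st_weight:
  "sum (st_weight h \<beta> Z) {(C, i). (C, i) \<in> st_states n E m \<and> card (C \<inter> P) = r} =
    (\<Sum>(q, i)\<in>{..n} \<times> {1..m}.
      real (card (overlap_cliques n E P r q)) * (exp (\<beta> i * h q) / Z (\<beta> i)))"
proof -
  let ?B = "{(C, i). (C, i) \<in> st_states n E m \<and> card (C \<inter> P) = r}"
  let ?g = "\<lambda>(C, i). (card C, i) :: nat \<times> nat"
  have B: "finite ?B" by (rule finite_subset[OF _ finite_st_states[of n E m]]) auto
  have "card C \<le> n" if "C \<in> cliques n E" for C
    using that card_mono[of "{..<n}" C] by (auto simp: cliques_def)
  then have im: "?g ` ?B \<subseteq> {..n} \<times> {1..m}"
    by (auto simp: st_states_def)
  have "sum (st_weight h \<beta> Z) ?B =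
      (\<Sum>p\<in>{..n} \<times> {1..m}. sum (st_weight h \<beta> Z) {x \<in> ?B. ?g x = p})"
    by (rule sum.group[symmetric, OF B _ im]) simp
  also have "\<dots> = (\<Sum>(q, i)\<in>{..n} \<times> {1..m}.
      real (card (overlap_cliques n E P r q)) * (exp (\<beta> i * h q) / Z (\<beta> i)))"
  proof (rule sum.cong[OF refl], clarify)
    fix q i assume i: "i \<in> {1..m}"
    have "{x \<in> ?B. ?g x = (q, i)} = overlap_cliques n E P r q \<times> {i}"
      using i by (auto simp: overlap_cliques_def st_states_def)
    moreover have "sum (st_weight h \<beta> Z) (overlap_cliques n E P r q \<times> {i}) =
        (\<Sum>x\<in>overlap_cliques n E P r q \<times> {i}. exp (\<beta> i * h q) / Z (\<beta> i))"
      by (rule sum.cong) (auto simp: overlap_cliques_def st_weight_def)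
    ultimately show "sum (st_weight h \<beta> Z) {x \<in> ?B. ?g x = (q, i)} =
        real (card (overlap_cliques n E P r q)) * (exp (\<beta> i * h q) / Z (\<beta> i))"
      by (simp add: card_cartesian_product)
  qed
  finally show ?thesis .
qed

text \<open>\<open>sum_st_weight\<close> expands the weights of overlap \<open>r\<close> and overlap
  0 with the same nonnegative coefficients, so \<open>le\<close> compares them term by term and
  \<open>exists_slow_start\<close> applies.\<close>

lemma st_slow_start:
  assumes params: "st_params m \<beta> Z a"
    and le: "\<And>q. real (card (overlap_cliques n E P r q)) \<le>
      \<delta> * real (card (overlap_cliques n E P 0 q))"
  shows "\<exists>x\<in>st_states n E m. measure (st_dynamics n E h m \<beta> Z a x)
    {\<omega>. \<exists>s<t. r < card (fst (\<omega> s) \<inter> P)} \<le> real t * \<delta>"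
proof -
  let ?S = "st_states n E m"
  let ?w = "st_weight h \<beta> Z"
  define B where "B r = {(C, i). (C, i) \<in> ?S \<and> card (C \<inter> P) = r}" for r
  define D where "D = {x :: nat set \<times> nat. card (fst x \<inter> P) \<le> r}"
  have "\<exists>x\<in>B 0. measure (markov_chain (st_kernel n E h m \<beta> Z a) x) {\<omega>. \<exists>s<t. \<omega> s \<notin> D} \<le> real t * \<delta>"
  proof (rule exists_slow_start[where S="?S" and w="?w" and B="B r"])
    show "finite ?S" by (rule finite_st_states)
    show "set_pmf (st_kernel n E h m \<beta> Z a z) \<subseteq> ?S" if "z \<in> ?S" for z
      using that set_pmf_st_kernel(1)[OF params] by (cases z) auto
    show "(\<Sum>x\<in>?S. ?w x * pmf (st_kernel n E h m \<beta> Z a x) y) = ?w y" if "y \<in> ?S" for y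
      by (rule st_stationary[OF params that])
    show "0 < ?w y" if "y \<in> ?S" for y by (rule st_weight_pos[OF params that])
    \<comment> \<open>The empty clique only witnesses that the averaging set is nonempty; it need
      not be the start that is obtained.\<close>
    have "({}, 1) \<in> B 0"
      using params by (auto simp: B_def st_states_def cliques_def st_params_def)
    then show "B 0 \<noteq> {}" by auto
    have "0 < Z (\<beta> i)" if "i \<in> {1..m}" for i
      using that params by (auto simp: st_params_def)
    then have "sum ?w (B r) \<le> (\<Sum>(q, i)\<in>{..n} \<times> {1..m}.
        \<delta> * real (card (overlap_cliques n E P 0 q)) * (exp (\<beta> i * h q) / Z (\<beta> i)))"
      unfolding B_def sum_st_weight
      by (intro sum_mono)
        (auto intro!: mult_right_mono le divide_right_mono intro: less_imp_le
          simp del: times_divide_eq_right)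
    also have "\<dots> = \<delta> * sum ?w (B 0)"
      unfolding B_def sum_st_weight by (simp add: sum_distrib_left case_prod_unfold mult.assoc)
    finally show "sum ?w (B r) \<le> \<delta> * sum ?w (B 0)" .
    \<comment> \<open>In \<open>D\<close> but off the bottleneck the overlap is strictly below
      \<open>r\<close>, and one step raises it by at most one, so \<open>r\<close> cannot be jumped
      over.\<close>
    show "y \<in> D" if z: "z \<in> ?S \<inter> D - B r" and y: "y \<in> set_pmf (st_kernel n E h m \<beta> Z a z)" for z y
    proof -
      obtain C i where [simp]: "z = (C, i)" by (cases z)
      obtain C' i' where [simp]: "y = (C', i')" by (cases y)
      have S: "(C, i) \<in> ?S" and less: "card (C \<inter> P) < r"
        using z by (auto simp: B_def D_def)
      have "(C', i') \<in> ?S"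
        using set_pmf_st_kernel(1)[OF params S] y by simp
      with S have C: "finite C" and C': "finite C'"
        by (auto simp: st_states_def cliques_def intro: finite_subset)
      have "C' = C \<or> card (sym_diff C C') = 1"
        using set_pmf_st_kernel(2)[OF params S] y by simp
      then have "card (sym_diff C C') \<le> 1" by auto
      moreover have "card (C' \<inter> P) \<le> card ((C \<inter> P) \<union> sym_diff C C')"
        using C C' by (intro card_mono) auto
      moreover have "card ((C \<inter> P) \<union> sym_diff C C') \<le> card (C \<inter> P) + card (sym_diff C C')"
        by (rule card_Un_le)
      ultimately show ?thesis using less by (simp add: D_def)
    qed
  qed (auto simp: B_def D_def)
  then show ?thesis
    by (auto simp: B_def D_def st_dynamics_def not_le)
qed


section \<open>Counting cliques in random graphs\<close>

lemma finite_all_pairs: "finite V \<Longrightarrow> finite (all_pairs V)"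
  by (auto simp: all_pairs_def intro: finite_subset[of _ "Pow V"])

lemma card_all_pairs: "finite V \<Longrightarrow> card (all_pairs V) = card V choose 2"
  unfolding all_pairs_def by (rule n_subsets)

lemma all_pairs_Int: "all_pairs V \<inter> all_pairs W = all_pairs (V \<inter> W)"
  by (auto simp: all_pairs_def)

lemma all_pairs_mono: "V \<subseteq> W \<Longrightarrow> all_pairs V \<subseteq> all_pairs W"
  by (auto simp: all_pairs_def)

text \<open>Puts the clique property into the form of an edge-set inclusion, to which
  \<open>prob_random_graph_superset\<close> applies.\<close>

lemma cliques_iff: "C \<in> cliques n E \<longleftrightarrow> C \<subseteq> {..<n} \<and> all_pairs C \<subseteq> E"
proof -
  have "(\<forall>u\<in>C. \<forall>v\<in>C. u \<noteq> v \<longrightarrow> {u, v} \<in> E) \<longleftrightarrow> all_pairs C \<subseteq> E"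
  proof
    assume "\<forall>u\<in>C. \<forall>v\<in>C. u \<noteq> v \<longrightarrow> {u, v} \<in> E"
    then show "all_pairs C \<subseteq> E" by (auto simp: all_pairs_def card_2_iff)
  next
    assume sub: "all_pairs C \<subseteq> E"
    show "\<forall>u\<in>C. \<forall>v\<in>C. u \<noteq> v \<longrightarrow> {u, v} \<in> E"
    proof (intro ballI impI)
      fix u v assume "u \<in> C" "v \<in> C" "u \<noteq> v"
      then have "{u, v} \<in> all_pairs C" by (simp add: all_pairs_def)
      with sub show "{u, v} \<in> E" by auto
    qed
  qed
  then show ?thesis by (auto simp: cliques_def)
qed

lemma finite_set_random_graph: "finite (set_pmf (random_graph n))"
  by (rule finite_subset[of _ "Pow (all_pairs {..<n})"])
    (auto simp: random_graph_def finite_all_pairs)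

section \<open>First and second moments of subgraph counts\<close>

lemma prob_random_graph_superset:
  assumes "F \<subseteq> all_pairs {..<n}"
  shows "measure (random_graph n) {E. F \<subseteq> E} = (1 / 2) ^ card F"
proof -
  let ?A = "all_pairs {..<n}"
  let ?P = "Pi_pmf ?A False (\<lambda>_. bernoulli_pmf (1 / 2))"
  have A: "finite ?A" by (simp add: finite_all_pairs)
  have "measure (random_graph n) {E. F \<subseteq> E} =
      measure ?P (Pi ?A (\<lambda>e. if e \<in> F then {True} else UNIV))"
    unfolding random_graph_def measure_map_pmf
    using assms by (intro arg_cong[where f="measure ?P"]) (auto simp: Pi_def split: if_splits)
  also have "\<dots> = (\<Prod>e\<in>?A. measure (bernoulli_pmf (1 / 2)) (if e \<in> F then {True} else UNIV))"
    by (rule measure_Pi_pmf_Pi[OF A])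
  also have "\<dots> = (\<Prod>e\<in>?A. if e \<in> F then 1 / 2 else 1)"
    by (rule prod.cong) (auto simp: measure_pmf_single)
  also have "\<dots> = (1 / 2) ^ card F"
    using assms A by (simp add: prod.If_cases Int_absorb1)
  finally show ?thesis .
qed

text \<open>The required edge set \<open>F C\<close> is kept general so that one computation covers
  cliques, pairs of cliques, and cliques whose pairs inside the planted set come for free.\<close>

lemma expectation_count_random_graph:
  assumes "finite \<C>" and F: "\<And>C. C \<in> \<C> \<Longrightarrow> F C \<subseteq> all_pairs {..<n}"
  shows "measure_pmf.expectation (random_graph n) (\<lambda>E. real (card {C \<in> \<C>. F C \<subseteq> E})) =
    (\<Sum>C\<in>\<C>. (1 / 2) ^ card (F C))"
proof -
  have "real (card {C \<in> \<C>. F C \<subseteq> E}) = (\<Sum>C\<in>\<C>. indicator {E. F C \<subseteq> E} E)" for E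
    using assms(1) by (simp add: indicator_def sum.If_cases Int_def)
  then have "measure_pmf.expectation (random_graph n) (\<lambda>E. real (card {C \<in> \<C>. F C \<subseteq> E})) =
      (\<Sum>C\<in>\<C>. measure_pmf.expectation (random_graph n) (indicator {E. F C \<subseteq> E}))"
    by (simp add: integral_sum' integrable_measure_pmf_finite[OF finite_set_random_graph])
  also have "\<dots> = (\<Sum>C\<in>\<C>. (1 / 2) ^ card (F C))"
    by (rule sum.cong) (simp_all add: prob_random_graph_superset[OF F])
  finally show ?thesis .
qed

text \<open>The square of the count is the count of ordered pairs with requirement
  \<open>F C \<union> F C'\<close>, so this is the first-moment formula again.\<close>

lemma expectation_count_square_random_graph:
  assumes "finite \<C>" and F: "\<And>C. C \<in> \<C> \<Longrightarrow> F C \<subseteq> all_pairs {..<n}"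
  shows "measure_pmf.expectation (random_graph n) (\<lambda>E. (real (card {C \<in> \<C>. F C \<subseteq> E}))\<^sup>2) =
    (\<Sum>C\<in>\<C>. \<Sum>C'\<in>\<C>. (1 / 2) ^ card (F C \<union> F C'))"
proof -
  have eq: "(real (card {C \<in> \<C>. F C \<subseteq> E}))\<^sup>2 =
      real (card {p \<in> \<C> \<times> \<C>. F (fst p) \<union> F (snd p) \<subseteq> E})" for E
  proof -
    have "{p \<in> \<C> \<times> \<C>. F (fst p) \<union> F (snd p) \<subseteq> E} = {C \<in> \<C>. F C \<subseteq> E} \<times> {C \<in> \<C>. F C \<subseteq> E}"
      by auto
    then show ?thesis by (simp add: card_cartesian_product power2_eq_square)
  qed
  have "measure_pmf.expectation (random_graph n)
      (\<lambda>E. real (card {p \<in> \<C> \<times> \<C>. F (fst p) \<union> F (snd p) \<subseteq> E})) =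
      (\<Sum>p\<in>\<C> \<times> \<C>. (1 / 2) ^ card (F (fst p) \<union> F (snd p)))"
    by (rule expectation_count_random_graph) (use assms(1) F in \<open>auto dest!: F\<close>)
  then show ?thesis
    by (simp only: eq sum.cartesian_product case_prod_unfold)
qed

section \<open>Binomial ratios\<close>

text \<open>A random \<open>q\<close>-subset of \<open>N\<close> points contains \<open>l\<close>
  given points with probability at most (q/N)^l; each induction step costs (q-l)/(N-l), which is at
  most q/N.\<close>

lemma binomial_diff_le:
  assumes "l \<le> q" "q \<le> N"
  shows "real (N - l choose (q - l)) * real N ^ l \<le> real (N choose q) * real q ^ l"
  using assms(1)
proof (induction l)
  case 0
  then show ?case by simp
next
  case (Suc l)
  have absorb: "(q - l) * (N - l choose (q - l)) = (N - l) * (N - Suc l choose (q - Suc l))"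
    using times_binomial_minus1_eq[of "q - l" "N - l"] Suc.prems by simp
  have Nl: "0 < N - l" using Suc.prems assms by simp
  have "real (q - l) * real N \<le> real q * real (N - l)"
  proof -
    have "real l * real q \<le> real l * real N" using assms by (intro mult_left_mono) auto
    then show ?thesis using Suc.prems assms by (simp add: of_nat_diff algebra_simps)
  qed
  have "real (N - Suc l choose (q - Suc l)) * real N ^ Suc l * real (N - l) =
      real ((N - l) * (N - Suc l choose (q - Suc l))) * real N * real N ^ l"
    by simp
  also have "\<dots> = (real (q - l) * real N) * (real (N - l choose (q - l)) * real N ^ l)"
    by (simp only: absorb[symmetric] of_nat_mult mult_ac)
  also have "\<dots> \<le> (real q * real (N - l)) * (real (N choose q) * real q ^ l)"
    using Suc.prems
    by (intro mult_mono[OF \<open>real (q - l) * real N \<le> real q * real (N - l)\<close> Suc.IH]) auto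
  also have "\<dots> = real (N choose q) * real q ^ Suc l * real (N - l)"
    by simp
  finally show ?case using Nl by simp
qed

text \<open>Lowering the bottom index from q-r to q-r-1 multiplies the binomial by (q-r)/(N-q+r+1),
  which is at most q/(N-q). Stated without division so that the induction stays
  multiplicative.\<close>

lemma binomial_lower_le:
  assumes "r \<le> q" "q < N"
  shows "real (N choose (q - r)) * (real N - real q) ^ r \<le> real (N choose q) * real q ^ r"
  using assms(1)
proof (induction r)
  case 0
  then show ?case by simp
next
  case (Suc r)
  have absorb: "(q - r) * (N choose (q - r)) = (N - (q - Suc r)) * (N choose (q - Suc r))"
  proof -
    have "(q - r) * (N choose (q - r)) = N * (N - 1 choose (q - Suc r))"
      using times_binomial_minus1_eq[of "q - r" N] Suc.prems by simp
    then show ?thesis using binomial_absorb_comp[of N "q - Suc r"] by simp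
  qed
  have le: "real N - real q \<le> real (N - (q - Suc r))" "0 \<le> real N - real q"
    using assms by auto
  have "real (N choose (q - Suc r)) * (real N - real q) ^ Suc r =
      (real N - real q) * real (N choose (q - Suc r)) * (real N - real q) ^ r" by simp
  also have "\<dots> \<le> real (N - (q - Suc r)) * real (N choose (q - Suc r)) * (real N - real q) ^ r"
    using le by (intro mult_right_mono) auto
  also have "\<dots> = real (q - r) * (real (N choose (q - r)) * (real N - real q) ^ r)"
    by (simp add: arg_cong[OF absorb, of real, unfolded of_nat_mult, symmetric] mult.assoc)
  also have "\<dots> \<le> real q * (real (N choose q) * real q ^ r)"
    using le Suc.prems by (intro mult_mono[OF _ Suc.IH]) auto
  finally show ?case by (simp add: mult_ac)
qed

text \<open>Replaces the quadratic exponent l(l-1)/2 by q l/2. The bound becomes an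
  \<open>l\<close>-th power, so that sums over the overlap \<open>l\<close> are dominated by
  geometric ones.\<close>

lemma two_power_choose_two_le:
  assumes "l \<le> q"
  shows "(2 :: real) ^ (l choose 2) \<le> (sqrt 2 ^ q) ^ l"
proof -
  have "(2 :: real) ^ (l choose 2) = sqrt 2 ^ (2 * (l choose 2))"
    by (simp add: power_mult)
  also have "2 * (l choose 2) = l * (l - 1)"
    unfolding choose_two by (cases l) auto
  also have "sqrt 2 ^ (l * (l - 1)) \<le> sqrt 2 ^ (q * l)"
    using mult_le_mono[of "l - 1" q l l] assms by (intro power_increasing) (auto simp: mult.commute)
  finally show ?thesis by (simp add: power_mult)
qed

section \<open>Second moment method for cliques of a given size\<close>

text \<open>Choose the intersection \<open>S\<close>, then the rest outside \<open>S\<close>. The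
  rest may still meet \<open>C\<close>, so this overcounts, which is harmless for an upper
  bound.\<close>

lemma card_subsets_overlap_le:
  assumes U: "finite U" and C: "C \<subseteq> U" "card C = q" and l: "l \<le> q"
  shows "card {C'. C' \<subseteq> U \<and> card C' = q \<and> card (C \<inter> C') = l} \<le>
    (q choose l) * (card U - l choose (q - l))"
proof -
  let ?D = "\<lambda>S. (\<lambda>T. S \<union> T) ` {T. T \<subseteq> U - S \<and> card T = q - l}"
  let ?S = "{S. S \<subseteq> C \<and> card S = l}"
  have finC: "finite C" using C U finite_subset by auto
  have finS: "finite ?S" using finC by (auto intro: finite_subset[of _ "Pow C"])
  have finD: "finite (?D S)" for S
    using U by (auto intro!: finite_imageI intro: finite_subset[of _ "Pow U"])
  have D: "card (?D S) \<le> card U - l choose (q - l)" if "S \<in> ?S" for S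
  proof -
    have S: "S \<subseteq> U" "finite S" "card S = l" using that C finC by (auto intro: finite_subset)
    have "card (?D S) \<le> card {T. T \<subseteq> U - S \<and> card T = q - l}"
      using U by (intro card_image_le) (auto intro: finite_subset[of _ "Pow U"])
    also have "\<dots> = card U - l choose (q - l)"
      using S U by (subst n_subsets) (auto simp: card_Diff_subset)
    finally show ?thesis .
  qed
  have "{C'. C' \<subseteq> U \<and> card C' = q \<and> card (C \<inter> C') = l} \<subseteq> (\<Union>S\<in>?S. ?D S)"
  proof
    fix C' assume "C' \<in> {C'. C' \<subseteq> U \<and> card C' = q \<and> card (C \<inter> C') = l}"
    then have C': "C' \<subseteq> U" "card C' = q" "card (C \<inter> C') = l" by auto
    moreover have "card (C' - C \<inter> C') = q - l"
      using C' finC by (subst card_Diff_subset) auto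
    moreover have "C' = C \<inter> C' \<union> (C' - C \<inter> C')" by auto
    ultimately show "C' \<in> (\<Union>S\<in>?S. ?D S)"
      by (intro UN_I[of "C \<inter> C'"] image_eqI[of _ _ "C' - C \<inter> C'"]) auto
  qed
  then have "card {C'. C' \<subseteq> U \<and> card C' = q \<and> card (C \<inter> C') = l} \<le> card (\<Union>S\<in>?S. ?D S)"
    using finS finD by (intro card_mono finite_UN_I) auto
  also have "\<dots> \<le> (\<Sum>S\<in>?S. card (?D S))" by (rule card_UN_le[OF finS])
  also have "\<dots> \<le> (\<Sum>S\<in>?S. card U - l choose (q - l))" by (intro sum_mono D)
  also have "\<dots> = (q choose l) * (card U - l choose (q - l))"
    using n_subsets[OF finC, of l] C by simp
  finally show ?thesis .
qed

text \<open>In the base of the \<open>l\<close>-th power, one factor \<open>q\<close> comes from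
  choosing the intersection inside \<open>C\<close>, q/N from \<open>binomial_diff_le\<close>, and
  the power of sqrt 2 from the shared pairs.\<close>

lemma sum_overlap_le:
  assumes U: "finite U" and C: "C \<subseteq> U" "card C = q"
  defines "N \<equiv> card U" and "\<C> \<equiv> {C'. C' \<subseteq> U \<and> card C' = q}"
  shows "(\<Sum>C'\<in>\<C>. 2 ^ (card (C \<inter> C') choose 2)) \<le>
    real (N choose q) * (1 + (\<Sum>l=2..q. ((real q)\<^sup>2 * sqrt 2 ^ q / real N) ^ l))"
proof -
  have fin: "finite \<C>" unfolding \<C>_def using U by (auto intro: finite_subset[of _ "Pow U"])
  have card_\<C>: "card \<C> = N choose q" unfolding \<C>_def N_def by (rule n_subsets[OF U])
  have finC: "finite C" using C U finite_subset by auto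
  have qN: "q \<le> N" using C U card_mono unfolding N_def by blast
  have overlap: "real (card {C' \<in> \<C>. card (C \<inter> C') = l}) * 2 ^ (l choose 2) \<le>
      real (N choose q) * ((real q)\<^sup>2 * sqrt 2 ^ q / real N) ^ l" if l: "l \<in> {2..q}" for l
  proof -
    have lq: "l \<le> q" and N: "0 < real N" using l qN by auto
    have "real (card {C' \<in> \<C>. card (C \<inter> C') = l}) \<le> real (q choose l) * real (N - l choose (q - l))"
      using card_subsets_overlap_le[OF U C lq] unfolding \<C>_def N_def
      by (simp flip: of_nat_mult add: conj_assoc)
    also have "\<dots> \<le> real q ^ l * (real (N choose q) * real q ^ l / real N ^ l)"
    proof (intro mult_mono)
      show "real (q choose l) \<le> real q ^ l"
        using binomial_le_pow[OF lq] by (simp flip: of_nat_power)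
      show "real (N - l choose (q - l)) \<le> real (N choose q) * real q ^ l / real N ^ l"
        using binomial_diff_le[OF lq qN] N by (simp add: pos_le_divide_eq)
    qed auto
    finally have "real (card {C' \<in> \<C>. card (C \<inter> C') = l}) * 2 ^ (l choose 2) \<le>
        real q ^ l * (real (N choose q) * real q ^ l / real N ^ l) * (sqrt 2 ^ q) ^ l"
      using two_power_choose_two_le[OF lq] by (intro mult_mono) auto
    then show ?thesis
      by (simp add: power_mult_distrib power_divide power2_eq_square mult_ac)
  qed
  \<comment> \<open>Overlaps 0 and 1 share no pair and are covered by the leading 1; hence the sum
    starts at 2.\<close>
  have "2 ^ (card (C \<inter> C') choose 2) \<le>
      1 + (\<Sum>l=2..q. if card (C \<inter> C') = l then 2 ^ (l choose 2) else 0 :: real)" for C'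
  proof (cases "2 \<le> card (C \<inter> C')")
    case True
    moreover have "card (C \<inter> C') \<le> q" using card_mono[OF finC, of "C \<inter> C'"] C by simp
    ultimately show ?thesis by simp
  next
    case False
    then have zero: "card (C \<inter> C') choose 2 = 0" by (simp add: not_le binomial_eq_0)
    show ?thesis unfolding zero by (simp add: sum_nonneg)
  qed
  then have "(\<Sum>C'\<in>\<C>. 2 ^ (card (C \<inter> C') choose 2)) \<le>
      (\<Sum>C'\<in>\<C>. 1 + (\<Sum>l=2..q. if card (C \<inter> C') = l then 2 ^ (l choose 2) else 0 :: real))"
    by (intro sum_mono)
  also have "\<dots> = real (card \<C>) + (\<Sum>l=2..q. \<Sum>C'\<in>\<C>. if card (C \<inter> C') = l then 2 ^ (l choose 2) else 0)"
    unfolding sum.distrib by (subst (2) sum.swap) simp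
  also have "\<dots> = real (card \<C>) + (\<Sum>l=2..q. real (card {C' \<in> \<C>. card (C \<inter> C') = l}) * 2 ^ (l choose 2))"
    using fin by (simp add: sum.If_cases Int_def mult.commute)
  also have "\<dots> \<le> real (N choose q) + (\<Sum>l=2..q. real (N choose q) * ((real q)\<^sup>2 * sqrt 2 ^ q / real N) ^ l)"
    unfolding card_\<C> by (intro add_left_mono sum_mono overlap)
  finally show ?thesis by (simp add: distrib_left sum_distrib_left)
qed

lemma sum_power_from_2_le:
  fixes x :: real
  assumes "0 \<le> x" "x \<le> 1 / 2"
  shows "(\<Sum>l=2..q. x ^ l) \<le> 2 * x\<^sup>2"
proof (cases "q = 0")
  case False
  then have "1 \<le> q" by simp
  then have "(1 - x) * (\<Sum>l=2..q. x ^ l) = x\<^sup>2 - x ^ Suc q"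
  proof (induction q rule: nat_induct_at_least)
    case (Suc q)
    have "(1 - x) * (\<Sum>l=2..Suc q. x ^ l) = (1 - x) * (\<Sum>l=2..q. x ^ l) + (1 - x) * x ^ Suc q"
      using Suc.hyps by (simp add: distrib_left)
    then show ?case unfolding Suc.IH by (simp add: algebra_simps)
  qed (simp add: power2_eq_square)
  then have "(1 - x) * (\<Sum>l=2..q. x ^ l) \<le> x\<^sup>2" using assms by simp
  moreover have "1 / 2 * (\<Sum>l=2..q. x ^ l) \<le> (1 - x) * (\<Sum>l=2..q. x ^ l)"
    using assms by (intro mult_right_mono sum_nonneg) auto
  ultimately show ?thesis by simp
qed (use assms in simp)

text \<open>Chebyshev at distance M/2 from the mean \<open>M\<close>. Only pairs of sets sharing at
  least two vertices are correlated, which bounds the variance by 2 x^2 M^2; dividing by (M/2)^2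
  gives the constant 8.\<close>

lemma prob_few_cliques_le:
  assumes U: "U \<subseteq> {..<n}" and q: "q \<le> card U"
  defines "x \<equiv> (real q)\<^sup>2 * sqrt 2 ^ q / real (card U)"
    and "M \<equiv> real (card U choose q) * (1 / 2) ^ (q choose 2)"
  assumes x: "x \<le> 1 / 2"
  shows "measure (random_graph n)
    {E. real (card {C. (C \<subseteq> U \<and> card C = q) \<and> all_pairs C \<subseteq> E}) < M / 2} \<le> 8 * x\<^sup>2"
proof -
  define \<C> where "\<C> = {C. C \<subseteq> U \<and> card C = q}"
  define X where "X E = real (card {C \<in> \<C>. all_pairs C \<subseteq> E})" for E
  have finU: "finite U" using U finite_subset by auto
  have fin: "finite \<C>" unfolding \<C>_def using finU by (auto intro: finite_subset[of _ "Pow U"])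
  have card_\<C>: "card \<C> = card U choose q" unfolding \<C>_def by (rule n_subsets[OF finU])
  have finC: "finite C" "card C = q" "card (all_pairs C) = q choose 2" if "C \<in> \<C>" for C
  proof -
    show "finite C" "card C = q" using that finU by (auto simp: \<C>_def intro: finite_subset)
    then show "card (all_pairs C) = q choose 2" by (simp add: card_all_pairs)
  qed
  have sub: "all_pairs C \<subseteq> all_pairs {..<n}" if "C \<in> \<C>" for C
    using that U by (intro all_pairs_mono) (auto simp: \<C>_def)
  have int: "integrable (random_graph n) f" for f :: "_ \<Rightarrow> real"
    by (rule integrable_measure_pmf_finite[OF finite_set_random_graph])
  have EX: "measure_pmf.expectation (random_graph n) X = M"
    unfolding X_def by (subst expectation_count_random_graph[OF fin]) (simp_all add: sub finC card_\<C> M_def)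
  have M: "0 < M" using q by (simp add: M_def zero_less_binomial_iff)
  have x0: "0 \<le> x" by (simp add: x_def)
  have "(\<Sum>C'\<in>\<C>. (1 / 2) ^ card (all_pairs C \<union> all_pairs C')) \<le> (1 / 2) ^ (q choose 2) * (M * (1 + 2 * x\<^sup>2))"
    if C: "C \<in> \<C>" for C
  proof -
    have "(1 / 2 :: real) ^ card (all_pairs C \<union> all_pairs C') =
        ((1 / 2) ^ (q choose 2))\<^sup>2 * 2 ^ (card (C \<inter> C') choose 2)" if "C' \<in> \<C>" for C'
    proof -
      have "card (all_pairs C \<union> all_pairs C') + (card (C \<inter> C') choose 2) = 2 * (q choose 2)"
        using card_Un_Int[of "all_pairs C" "all_pairs C'"] finC[OF C] finC[OF that]
        by (simp add: finite_all_pairs all_pairs_Int card_all_pairs)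
      then have "(1 / 2 :: real) ^ card (all_pairs C \<union> all_pairs C') * (1 / 2) ^ (card (C \<inter> C') choose 2) =
          ((1 / 2) ^ (q choose 2))\<^sup>2"
        by (simp flip: power_add power_mult add: mult.commute)
      then show ?thesis by (simp add: power_one_over field_simps)
    qed
    then have "(\<Sum>C'\<in>\<C>. (1 / 2 :: real) ^ card (all_pairs C \<union> all_pairs C')) =
        ((1 / 2) ^ (q choose 2))\<^sup>2 * (\<Sum>C'\<in>\<C>. 2 ^ (card (C \<inter> C') choose 2))"
      by (simp add: sum_distrib_left)
    also have "\<dots> \<le> ((1 / 2) ^ (q choose 2))\<^sup>2 * (real (card U choose q) * (1 + 2 * x\<^sup>2))"
    proof (rule mult_left_mono)
      have "(\<Sum>C'\<in>\<C>. 2 ^ (card (C \<inter> C') choose 2)) \<le>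
          real (card U choose q) * (1 + (\<Sum>l=2..q. x ^ l))"
        using sum_overlap_le[OF finU, of C q] C by (simp add: \<C>_def x_def)
      also have "\<dots> \<le> real (card U choose q) * (1 + 2 * x\<^sup>2)"
        by (intro mult_left_mono add_left_mono sum_power_from_2_le x x0) simp
      finally show "(\<Sum>C'\<in>\<C>. 2 ^ (card (C \<inter> C') choose 2)) \<le>
          real (card U choose q) * (1 + 2 * x\<^sup>2)" .
    qed simp
    finally show ?thesis by (simp add: M_def power2_eq_square mult_ac)
  qed
  then have "measure_pmf.expectation (random_graph n) (\<lambda>E. (X E)\<^sup>2) \<le>
      (\<Sum>C\<in>\<C>. (1 / 2) ^ (q choose 2) * (M * (1 + 2 * x\<^sup>2)))"
    unfolding X_def
    by (subst expectation_count_square_random_graph[OF fin]) (use sub in \<open>auto simp del: sum_constant intro!: sum_mono\<close>)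
  also have "\<dots> = M\<^sup>2 * (1 + 2 * x\<^sup>2)"
    by (simp add: card_\<C>) (simp add: M_def power2_eq_square)
  finally have EX2: "measure_pmf.expectation (random_graph n) (\<lambda>E. (X E)\<^sup>2) \<le> M\<^sup>2 * (1 + 2 * x\<^sup>2)" .
  have "measure (random_graph n) {E. X E < M / 2} \<le>
      measure (random_graph n) {E \<in> space (random_graph n). M / 2 \<le> \<bar>X E - M\<bar>}"
    by (rule measure_pmf.finite_measure_mono) (auto simp: abs_if)
  also have "\<dots> \<le> measure_pmf.variance (random_graph n) X / (M / 2)\<^sup>2"
    using measure_pmf.Chebyshev_inequality[of X "random_graph n" "M / 2"] int M by (simp add: EX)
  also have "\<dots> \<le> (M\<^sup>2 * (2 * x\<^sup>2)) / (M / 2)\<^sup>2"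
  proof (rule divide_right_mono)
    have "measure_pmf.variance (random_graph n) X =
        measure_pmf.expectation (random_graph n) (\<lambda>E. (X E)\<^sup>2) - M\<^sup>2"
      by (subst measure_pmf.variance_eq) (simp_all add: int EX)
    then show "measure_pmf.variance (random_graph n) X \<le> M\<^sup>2 * (2 * x\<^sup>2)"
      using EX2 by (simp add: distrib_left)
  qed simp
  also have "\<dots> = 8 * x\<^sup>2" using M by (simp add: power2_eq_square)
  finally show ?thesis by (simp add: X_def \<C>_def)
qed

section \<open>Cliques with prescribed overlap with the planted set\<close>

lemma overlap_cliques_union_all_pairs:
  assumes "P \<subseteq> {..<n}"
  shows "overlap_cliques n (E \<union> all_pairs P) P r q =
    {C \<in> {C. C \<subseteq> {..<n} \<and> card C = q \<and> card (C \<inter> P) = r}. all_pairs C - all_pairs P \<subseteq> E}"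
  unfolding overlap_cliques_def cliques_iff by auto

text \<open>A set avoiding \<open>P\<close> contains no planted pair, so planting does not affect
  these cliques and the second moment bound for the plain random graph applies to them.\<close>

lemma overlap_cliques_0:
  assumes "P \<subseteq> {..<n}"
  shows "overlap_cliques n (E \<union> all_pairs P) P 0 q =
    {C. (C \<subseteq> {..<n} - P \<and> card C = q) \<and> all_pairs C \<subseteq> E}"
proof -
  have fin: "finite P" using assms finite_subset by auto
  have eq: "C \<subseteq> {..<n} \<and> card (C \<inter> P) = 0 \<longleftrightarrow> C \<subseteq> {..<n} - P" for C
    using fin by (auto simp: card_eq_0_iff)
  have empty: "all_pairs {} = {}" by (auto simp: all_pairs_def)
  have "all_pairs C - all_pairs P = all_pairs C" if "C \<subseteq> {..<n} - P" for C
  proof -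
    have "C \<inter> P = {}" using that by auto
    then show ?thesis using all_pairs_Int[of C P] empty by auto
  qed
  then show ?thesis
    unfolding overlap_cliques_union_all_pairs[OF assms] using eq by (intro set_eqI) (simp, metis)
qed

text \<open>The bound is the expected number of overlap-0 cliques of size \<open>q\<close> times an
  \<open>r\<close>-th power. Its base collects \<open>k\<close> choices of a planted vertex,
  q/(n-k-q) for one outside vertex fewer, and the saving from pairs inside \<open>P\<close>.\<close>

lemma expectation_overlap_cliques_le:
  assumes P: "P \<subseteq> {..<n}" "card P = k" and q: "q < n - k"
  shows "measure_pmf.expectation (random_graph n)
      (\<lambda>E. real (card (overlap_cliques n (E \<union> all_pairs P) P r q))) \<le>
    real (n - k choose q) * (1 / 2) ^ (q choose 2) *
      (real k * real q * sqrt 2 ^ r / (real (n - k) - real q)) ^ r"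
proof -
  let ?D = "{C. C \<subseteq> {..<n} \<and> card C = q \<and> card (C \<inter> P) = r}"
  let ?N = "n - k"
  have finP: "finite P" using P finite_subset by auto
  have finD: "finite ?D" by (auto intro: finite_subset[of _ "Pow {..<n}"])
  have sub: "all_pairs C - all_pairs P \<subseteq> all_pairs {..<n}" if "C \<in> ?D" for C
    using that all_pairs_mono[of C "{..<n}"] by auto
  have "measure_pmf.expectation (random_graph n)
      (\<lambda>E. real (card (overlap_cliques n (E \<union> all_pairs P) P r q))) =
      (\<Sum>C\<in>?D. (1 / 2) ^ card (all_pairs C - all_pairs P))"
    unfolding overlap_cliques_union_all_pairs[OF P(1)]
    by (rule expectation_count_random_graph[OF finD sub])
  also have "\<dots> \<le> (\<Sum>C\<in>?D. (1 / 2) ^ (q choose 2) * 2 ^ (r choose 2))"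
  proof (rule sum_mono)
    fix C assume C: "C \<in> ?D"
    then have finC: "finite C" by (auto intro: finite_subset)
    have "card (all_pairs C - all_pairs P) = (q choose 2) - (r choose 2)"
      using C finC finP by (simp add: card_Diff_subset_Int finite_all_pairs all_pairs_Int card_all_pairs)
    moreover have "r choose 2 \<le> q choose 2"
      using C finC card_mono[of "all_pairs C" "all_pairs (C \<inter> P)"] all_pairs_mono[of "C \<inter> P" C]
      by (simp add: finite_all_pairs card_all_pairs)
    ultimately show "(1 / 2 :: real) ^ card (all_pairs C - all_pairs P) \<le>
        (1 / 2) ^ (q choose 2) * 2 ^ (r choose 2)"
      by (simp add: power_diff power_one_over field_simps)
  qed
  also have "\<dots> = real (card ?D) * ((1 / 2) ^ (q choose 2) * 2 ^ (r choose 2))" by simp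
  also have "\<dots> \<le> real (?N choose q) * (real k * real q / (real ?N - real q)) ^ r *
      ((1 / 2) ^ (q choose 2) * (sqrt 2 ^ r) ^ r)"
  proof (intro mult_mono)
    show "(2 :: real) ^ (r choose 2) \<le> (sqrt 2 ^ r) ^ r" by (rule two_power_choose_two_le) simp
    show "real (card ?D) \<le> real (?N choose q) * (real k * real q / (real ?N - real q)) ^ r"
    \<comment> \<open>The binomial estimates need \<open>r \<le> q\<close> and
      \<open>r \<le> k\<close>, which a member of \<open>?D\<close> supplies.\<close>
    proof (cases "?D = {}")
      case True
      then show ?thesis using q by (simp only:) (simp add: zero_le_mult_iff)
    next
      case False
      then obtain C where C: "C \<subseteq> {..<n}" "card C = q" "card (C \<inter> P) = r" by auto
      have "finite C" using C finite_subset by auto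
      then have rq: "r \<le> q" using card_mono[of C "C \<inter> P"] C by auto
      have rk: "r \<le> k" using card_mono[of P "C \<inter> P"] C P finP by auto
      let ?S = "{S. S \<subseteq> P \<and> card S = r}" and ?T = "{T. T \<subseteq> {..<n} - P \<and> card T = q - r}"
      have fin: "finite (?S \<times> ?T)"
        using finP by (auto intro!: finite_cartesian_product intro: finite_subset[of _ "Pow P"]
            finite_subset[of _ "Pow {..<n}"])
      have "?D \<subseteq> (\<lambda>(S, T). S \<union> T) ` (?S \<times> ?T)"
      proof
        fix C assume C: "C \<in> ?D"
        then have "finite C" by (auto intro: finite_subset)
        then have "card (C - P) = q - r"
          using C by (simp add: card_Diff_subset_Int)
        moreover have "C = (C \<inter> P) \<union> (C - P)" by auto
        ultimately show "C \<in> (\<lambda>(S, T). S \<union> T) ` (?S \<times> ?T)"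
          using C by (intro image_eqI[of _ _ "(C \<inter> P, C - P)"]) auto
      qed
      then have "card ?D \<le> card (?S \<times> ?T)"
        using surj_card_le[OF fin] by blast
      also have "\<dots> = (k choose r) * (?N choose (q - r))"
        using n_subsets[OF finP, of r] n_subsets[of "{..<n} - P" "q - r"] P finP
        by (simp add: card_cartesian_product card_Diff_subset)
      finally have "real (card ?D) \<le> real (k choose r) * real (?N choose (q - r))"
        by (simp flip: of_nat_mult)
      also have "\<dots> \<le> real k ^ r * (real (?N choose q) * real q ^ r / (real ?N - real q) ^ r)"
      proof (intro mult_mono)
        show "real (k choose r) \<le> real k ^ r"
          using binomial_le_pow[OF rk] by (simp flip: of_nat_power)
        have "0 < real ?N - real q" using q by linarith
        then show "real (?N choose (q - r)) \<le>
            real (?N choose q) * real q ^ r / (real ?N - real q) ^ r"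
          using binomial_lower_le[OF rq q] by (simp add: pos_le_divide_eq)
      qed auto
      finally show ?thesis by (simp add: power_mult_distrib power_divide mult_ac)
    qed
  qed (use q in \<open>auto simp: zero_le_mult_iff\<close>)
  also have "\<dots> = real (?N choose q) * (1 / 2) ^ (q choose 2) *
      (real k * real q * sqrt 2 ^ r / (real ?N - real q)) ^ r"
    by (simp add: power_mult_distrib power_divide mult_ac)
  finally show ?thesis .
qed

text \<open>Deleting vertices outside \<open>P\<close> shrinks a larger clique to size
  \<open>q\<close> with the same overlap, so absence at one size rules out all larger sizes.\<close>

lemma overlap_cliques_empty_mono:
  assumes "overlap_cliques n E P r q = {}" and "r \<le> q" "q \<le> q'"
  shows "overlap_cliques n E P r q' = {}"
proof (rule ccontr)
  assume "overlap_cliques n E P r q' \<noteq> {}"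
  then obtain C where C: "C \<subseteq> {..<n}" "all_pairs C \<subseteq> E" "card C = q'" "card (C \<inter> P) = r"
    by (auto simp: overlap_cliques_def cliques_iff)
  have finC: "finite C" using C finite_subset by auto
  then have "card (C - P) = q' - r" using C by (simp add: card_Diff_subset_Int)
  then obtain T where T: "T \<subseteq> C - P" "card T = q - r" "finite T"
    using obtain_subset_with_card_n[of "q - r" "C - P"] assms(3)
    by (metis diff_le_mono)
  let ?C = "(C \<inter> P) \<union> T"
  have "?C \<subseteq> C" using T by auto
  moreover have "card ?C = q"
    using T C finC assms(2) by (subst card_Un_disjoint) auto
  moreover have "?C \<inter> P = C \<inter> P" using T by auto
  ultimately have "?C \<in> overlap_cliques n E P r q"
    using C all_pairs_mono[of ?C C] by (auto simp: overlap_cliques_def cliques_iff)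
  then show False using assms(1) by auto
qed

text \<open>Below \<open>q\<^sub>0\<close>, Markov bounds overlap \<open>r\<close> by
  \<open>s * M q\<close> and Chebyshev keeps overlap 0 above \<open>M q / 2\<close>;
  \<open>M q\<close> cancels in the ratio. At \<open>q\<^sub>0\<close>, Markov with threshold 1
  leaves no clique of overlap \<open>r\<close>, which costs the factor \<open>M q\<^sub>0\<close> in
  the last term. The values \<open>x\<close> and \<open>y\<close> at \<open>q\<^sub>0\<close>
  dominate those at smaller sizes.\<close>

lemma prob_overlap_cliques_bad_le:
  fixes n k r q\<^sub>0 :: nat and s :: real
  assumes P: "P \<subseteq> {..<n}" "card P = k" and q0: "q\<^sub>0 < n - k" and r: "r \<le> q\<^sub>0" and s: "0 < s"
  defines "x \<equiv> (real q\<^sub>0)\<^sup>2 * sqrt 2 ^ q\<^sub>0 / real (n - k)"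
    and "y \<equiv> real k * real q\<^sub>0 * sqrt 2 ^ r / (real (n - k) - real q\<^sub>0)"
  assumes x: "x \<le> 1 / 2"
  shows "measure (random_graph n) {E. \<not> (\<forall>q.
      real (card (overlap_cliques n (E \<union> all_pairs P) P r q)) \<le>
        2 * s * real (card (overlap_cliques n (E \<union> all_pairs P) P 0 q)))} \<le>
    real q\<^sub>0 * (8 * x\<^sup>2 + y ^ r / s) + real (n - k choose q\<^sub>0) * (1 / 2) ^ (q\<^sub>0 choose 2) * y ^ r"
proof -
  let ?R = "random_graph n"
  let ?N = "n - k"
  define W where "W j q E = real (card (overlap_cliques n (E \<union> all_pairs P) P j q))" for j q E
  define M where "M q = real (?N choose q) * (1 / 2) ^ (q choose 2)" for q
  have finP: "finite P" using P finite_subset by auto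
  have cardU: "card ({..<n} - P) = ?N" using P finP by (simp add: card_Diff_subset)
  have M: "0 < M q" if "q \<le> q\<^sub>0" for q
    using that q0 by (simp add: M_def zero_less_binomial_iff)
  have int: "integrable ?R f" for f :: "_ \<Rightarrow> real"
    by (rule integrable_measure_pmf_finite[OF finite_set_random_graph])
  have EW: "measure_pmf.expectation ?R (W r q) \<le> M q * y ^ r" if q: "q \<le> q\<^sub>0" for q
  proof -
    have "measure_pmf.expectation ?R (W r q) \<le>
        M q * (real k * real q * sqrt 2 ^ r / (real ?N - real q)) ^ r"
      using expectation_overlap_cliques_le[OF P, of q r] q q0 by (simp add: W_def[abs_def] M_def)
    also have "\<dots> \<le> M q * y ^ r"
      unfolding y_def using q q0 M[OF q]
      by (intro mult_left_mono power_mono frac_le mult_right_mono mult_nonneg_nonneg divide_nonneg_pos) auto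
    finally show ?thesis .
  qed
  have few: "measure ?R {E. W 0 q E < M q / 2} \<le> 8 * x\<^sup>2" if q: "q < q\<^sub>0" for q
  proof -
    let ?x = "(real q)\<^sup>2 * sqrt 2 ^ q / real ?N"
    have le: "?x \<le> x"
      unfolding x_def using q by (intro divide_right_mono mult_mono power_mono power_increasing) auto
    have "measure ?R {E. W 0 q E < M q / 2} \<le> 8 * ?x\<^sup>2"
      using prob_few_cliques_le[of "{..<n} - P" n q] order.trans[OF le x] q q0
      unfolding W_def M_def overlap_cliques_0[OF P(1)] cardU by simp
    also have "\<dots> \<le> 8 * x\<^sup>2" using le by (intro mult_left_mono power_mono) auto
    finally show ?thesis .
  qed
  have many: "measure ?R {E. s * M q \<le> W r q E} \<le> y ^ r / s" if q: "q < q\<^sub>0" for q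
  proof -
    have pos: "0 < s * M q" using M[of q] q s by simp
    have "measure ?R {E. s * M q \<le> W r q E} \<le> measure_pmf.expectation ?R (W r q) / (s * M q)"
      using integral_Markov_inequality_measure[of ?R "W r q" UNIV "s * M q"] int pos
      by (simp add: W_def[abs_def])
    also have "\<dots> \<le> M q * y ^ r / (s * M q)"
      using EW[of q] q pos by (intro divide_right_mono) auto
    also have "\<dots> = y ^ r / s" using M[of q] q by simp
    finally show ?thesis .
  qed
  have none: "measure ?R {E. 1 \<le> W r q\<^sub>0 E} \<le> M q\<^sub>0 * y ^ r"
    using integral_Markov_inequality_measure[of ?R "W r q\<^sub>0" UNIV 1] int EW[of "q\<^sub>0"]
    by (simp add: W_def[abs_def])
  have bad: "{E. \<not> (\<forall>q. W r q E \<le> 2 * s * W 0 q E)} \<subseteq>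
      (\<Union>q<q\<^sub>0. {E. W 0 q E < M q / 2} \<union> {E. s * M q \<le> W r q E}) \<union> {E. 1 \<le> W r q\<^sub>0 E}"
  proof (rule subsetI, rule ccontr)
    fix E assume E: "E \<in> {E. \<not> (\<forall>q. W r q E \<le> 2 * s * W 0 q E)}"
      and not: "E \<notin> (\<Union>q<q\<^sub>0. {E. W 0 q E < M q / 2} \<union> {E. s * M q \<le> W r q E}) \<union> {E. 1 \<le> W r q\<^sub>0 E}"
    have "W r q E \<le> 2 * s * W 0 q E" for q
    proof (cases "q < q\<^sub>0")
      case True
      then have "W r q E < s * M q" "M q / 2 \<le> W 0 q E" using not by (auto simp: not_le not_less)
      moreover have "s * M q \<le> s * (2 * W 0 q E)"
        using \<open>M q / 2 \<le> W 0 q E\<close> s by (intro mult_left_mono) auto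
      ultimately show ?thesis by simp
    next
      case False
      have "W r q\<^sub>0 E < 1" using not by auto
      then have "overlap_cliques n (E \<union> all_pairs P) P r q\<^sub>0 = {}"
        using finite_overlap_cliques by (simp add: W_def)
      then have "overlap_cliques n (E \<union> all_pairs P) P r q = {}"
        by (rule overlap_cliques_empty_mono[OF _ r]) (use False in simp)
      then show ?thesis using s by (simp add: W_def)
    qed
    with E show False by simp
  qed
  have "measure ?R {E. \<not> (\<forall>q. W r q E \<le> 2 * s * W 0 q E)} \<le>
      measure ?R ((\<Union>q<q\<^sub>0. {E. W 0 q E < M q / 2} \<union> {E. s * M q \<le> W r q E}) \<union> {E. 1 \<le> W r q\<^sub>0 E})"
    by (rule measure_pmf.finite_measure_mono[OF bad]) simp
  also have "\<dots> \<le> measure ?R (\<Union>q<q\<^sub>0. {E. W 0 q E < M q / 2} \<union> {E. s * M q \<le> W r q E}) +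
      measure ?R {E. 1 \<le> W r q\<^sub>0 E}"
    by (rule measure_Un_le) auto
  also have "\<dots> \<le> (\<Sum>q<q\<^sub>0. measure ?R ({E. W 0 q E < M q / 2} \<union> {E. s * M q \<le> W r q E})) + M q\<^sub>0 * y ^ r"
    by (intro add_mono none measure_pmf.finite_measure_subadditive_finite) auto
  also have "\<dots> \<le> (\<Sum>q<q\<^sub>0. 8 * x\<^sup>2 + y ^ r / s) + M q\<^sub>0 * y ^ r"
  proof (intro add_right_mono sum_mono)
    fix q assume "q \<in> {..<q\<^sub>0}"
    then have q: "q < q\<^sub>0" by simp
    have "measure ?R ({E. W 0 q E < M q / 2} \<union> {E. s * M q \<le> W r q E}) \<le>
        measure ?R {E. W 0 q E < M q / 2} + measure ?R {E. s * M q \<le> W r q E}"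
      by (rule measure_Un_le) auto
    with few[OF q] many[OF q]
    show "measure ?R ({E. W 0 q E < M q / 2} \<union> {E. s * M q \<le> W r q E}) \<le> 8 * x\<^sup>2 + y ^ r / s"
      by linarith
  qed
  finally show ?thesis by (simp add: W_def M_def)
qed

text \<open>The random graph and the planted set are independent, so the draws commute and the law
  is a mixture over \<open>P\<close>; a bound uniform in \<open>P\<close> survives the
  averaging.\<close>

lemma prob_planted_clique_le:
  assumes "k \<le> n"
    and le: "\<And>P. P \<subseteq> {..<n} \<Longrightarrow> card P = k \<Longrightarrow>
      measure (random_graph n) {E. (E \<union> all_pairs P, P) \<in> X} \<le> \<epsilon>"
  shows "measure (planted_clique n k) X \<le> \<epsilon>"
proof -
  let ?S = "pmf_of_set {S. S \<subseteq> {..<n} \<and> card S = k}"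
  have fin: "finite {S. S \<subseteq> {..<n} \<and> card S = k}"
    by (auto intro: finite_subset[of _ "Pow {..<n}"])
  have "card {S. S \<subseteq> {..<n} \<and> card S = k} \<noteq> 0"
    using n_subsets[of "{..<n}" k] assms(1) by simp
  then have ne: "{S. S \<subseteq> {..<n} \<and> card S = k} \<noteq> {}" by force
  have "planted_clique n k = bind_pmf ?S (\<lambda>P. map_pmf (\<lambda>E. (E \<union> all_pairs P, P)) (random_graph n))"
    unfolding planted_clique_def pair_pmf_def map_bind_pmf
    by (subst bind_commute_pmf) (simp add: map_pmf_def bind_assoc_pmf bind_return_pmf)
  then have "emeasure (planted_clique n k) X =
      (\<integral>\<^sup>+P. emeasure (random_graph n) {E. (E \<union> all_pairs P, P) \<in> X} \<partial>?S)"
    by (simp add: vimage_def)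
  also have "\<dots> \<le> (\<integral>\<^sup>+P. ennreal \<epsilon> \<partial>?S)"
    using fin ne le
    by (intro nn_integral_mono_AE)
      (auto simp: AE_measure_pmf_iff measure_pmf.emeasure_eq_measure intro!: ennreal_leI)
  also have "\<dots> = ennreal \<epsilon>" by simp
  finally have *: "emeasure (planted_clique n k) X \<le> ennreal \<epsilon>" .
  obtain P where "P \<subseteq> {..<n}" "card P = k" using ne by auto
  then have "0 \<le> \<epsilon>" using le[of P] measure_nonneg[of "random_graph n"] order.trans by blast
  then show ?thesis using * by (simp add: measure_pmf.emeasure_eq_measure)
qed


section \<open>Asymptotics\<close>

lemma le_hitting_time_iff:
  "ereal b \<le> ereal_of_enat (hitting_time A \<omega>) \<longleftrightarrow> (\<forall>s. real s < b \<longrightarrow> \<omega> s \<notin> A)"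
proof
  assume b: "ereal b \<le> ereal_of_enat (hitting_time A \<omega>)"
  show "\<forall>s. real s < b \<longrightarrow> \<omega> s \<notin> A"
  proof (intro allI impI notI)
    fix s assume "real s < b" "\<omega> s \<in> A"
    then have "hitting_time A \<omega> \<le> enat s"
      unfolding hitting_time_def by (auto intro: INF_lower)
    then have "ereal_of_enat (hitting_time A \<omega>) \<le> ereal_of_enat (enat s)"
      by (simp only: ereal_of_enat_le_iff)
    with b have "ereal b \<le> ereal_of_enat (enat s)" by (rule order.trans)
    with \<open>real s < b\<close> show False by simp
  qed
next
  assume b: "\<forall>s. real s < b \<longrightarrow> \<omega> s \<notin> A"
  show "ereal b \<le> ereal_of_enat (hitting_time A \<omega>)"
  proof (cases "{t. \<omega> t \<in> A} = {}")
    case True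
    then show ?thesis by (simp add: hitting_time_def top_enat_def)
  next
    case False
    then obtain t where "\<omega> t \<in> A" by auto
    then have "hitting_time A \<omega> \<in> enat ` {t. \<omega> t \<in> A}"
      unfolding hitting_time_def by (intro wellorder_InfI[of "enat t"]) auto
    then show ?thesis using b by (auto simp: not_less[symmetric])
  qed
qed

lemma less_hitting_time_iff:
  "enat N < hitting_time A \<omega> \<longleftrightarrow> (\<forall>s\<le>N. \<omega> s \<notin> A)"
proof -
  have "enat N < hitting_time A \<omega> \<longleftrightarrow> enat (Suc N) \<le> hitting_time A \<omega>"
    by (simp add: Suc_ile_eq)
  also have "\<dots> \<longleftrightarrow> ereal (real (Suc N)) \<le> ereal_of_enat (hitting_time A \<omega>)"
    by (metis ereal_of_enat_le_iff ereal_of_enat_simps(1))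
  also have "\<dots> \<longleftrightarrow> (\<forall>s\<le>N. \<omega> s \<notin> A)"
    unfolding le_hitting_time_iff of_nat_less_iff less_Suc_eq_le ..
  finally show ?thesis .
qed

text \<open>The time window \<open>Q\<close> is abstract because it is used both with a real-valued
  bound on the time and with \<open>s \<le> n ^ d\<close>.\<close>

lemma prob_avoid_ge:
  assumes le: "measure (markov_chain K x) {\<omega>. \<exists>s<t. \<omega> s \<in> B} \<le> \<delta>"
    and A: "A \<subseteq> B" and Q: "\<And>s. Q s \<Longrightarrow> s < t"
  shows "1 - \<delta> \<le> measure (markov_chain K x) {\<omega>. \<forall>s. Q s \<longrightarrow> \<omega> s \<notin> A}"
proof -
  interpret prob_space "markov_chain K x" by (rule prob_space_markov_chain)
  have B: "{\<omega>. \<exists>s<t. \<omega> s \<in> B} \<in> events"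
    by (rule in_sets_markov_chain) measurable
  have ev: "{\<omega>. \<forall>s. Q s \<longrightarrow> \<omega> s \<notin> A} \<in> events"
    by (rule in_sets_markov_chain) measurable
  have "1 - \<delta> \<le> prob (space (markov_chain K x) - {\<omega>. \<exists>s<t. \<omega> s \<in> B})"
    using le by (subst prob_compl[OF B]) simp
  also have "\<dots> \<le> prob {\<omega>. \<forall>s. Q s \<longrightarrow> \<omega> s \<notin> A}"
    using A Q by (intro finite_measure_mono[OF _ ev]) auto
  finally show ?thesis .
qed

text \<open>
  In the proof, the threshold size is \<open>q \<approx> (2 - \<kappa>/2) log n\<close>. It is far enough below
  \<open>2 log n\<close> for the second moment method, and the \<open>2 powr (\<kappa>/2 * (log n)\<^sup>2)\<close> cliques of size
  \<open>q\<close> expected outside \<open>P\<close> are few enough to be beaten by the factor \<open>2 powr (- \<kappa> * (log n)\<^sup>2)\<close>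
  gained from the overlap.
\<close>

lemma overlap_cliques_rare:
  fixes \<alpha> \<rho> \<kappa> :: real
  assumes \<alpha>: "0 < \<alpha>" "\<alpha> < 1" and \<rho>: "0 < \<rho>" "\<rho> \<le> (1 - \<alpha>) / 2"
  defines "\<kappa> \<equiv> (1 - \<alpha>) * \<rho> / 4"
  shows "\<exists>\<eta>. \<eta> \<longlonglongrightarrow> 0 \<and> (\<forall>\<^sub>F n in sequentially. \<forall>P\<subseteq>{..<n}. card P = nat \<lfloor>real n powr \<alpha>\<rfloor> \<longrightarrow>
    measure (random_graph n) {E. \<not> (\<forall>q.
      real (card (overlap_cliques n (E \<union> all_pairs P) P (nat \<lfloor>\<rho> * log 2 n\<rfloor>) q)) \<le>
        2 * 2 powr (- \<kappa> * (log 2 n)\<^sup>2 / 2) *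
          real (card (overlap_cliques n (E \<union> all_pairs P) P 0 q)))} \<le> \<eta> n)"
proof -
  define \<epsilon> where "\<epsilon> = \<kappa> / 2"
  have \<kappa>: "0 < \<kappa>" using \<alpha> \<rho> by (simp add: \<kappa>_def)
  have \<epsilon>: "0 < \<epsilon>" using \<kappa> by (simp add: \<epsilon>_def)
  have "\<kappa> \<le> 1 * 1 / 4"
    unfolding \<kappa>_def using \<alpha> \<rho> by (intro divide_right_mono mult_mono) auto
  then have \<epsilon>1: "\<epsilon> < 1" by (simp add: \<epsilon>_def)
  \<comment> \<open>Dominates \<open>x\<close>: 16 is 4 from the square of 2 log n, times 2 for
    rounding \<open>q\<close>, times 2 for n-k being at least n/2.\<close>
  define X where "X n = 16 * (log 2 (real n))\<^sup>2 * real n powr (- \<epsilon> / 2)" for n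
  \<comment> \<open>One term per failure: too few cliques of overlap 0, too many of overlap
    \<open>r\<close> below the threshold size, and any of overlap \<open>r\<close> at that
    size.\<close>
  define \<eta> where "\<eta> n = 2 * log 2 (real n) * (8 * (X n)\<^sup>2) +
    2 * log 2 (real n) * 2 powr (- \<kappa> * (log 2 (real n))\<^sup>2 / 2) +
    2 powr (log 2 (real n) - \<kappa> / 2 * (log 2 (real n))\<^sup>2)" for n
  have lim1: "(\<lambda>n. 2 * log 2 (real n) * (8 * (X n)\<^sup>2)) \<longlonglongrightarrow> 0"
    unfolding X_def using \<epsilon> by real_asymp
  have lim2: "(\<lambda>n. 2 * log 2 (real n) * 2 powr (- \<kappa> * (log 2 (real n))\<^sup>2 / 2)) \<longlonglongrightarrow> 0"
    using \<kappa> by real_asymp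
  have lim3: "(\<lambda>n. 2 powr (log 2 (real n) - \<kappa> / 2 * (log 2 (real n))\<^sup>2)) \<longlonglongrightarrow> 0"
    using \<kappa> by real_asymp
  have lim: "\<eta> \<longlonglongrightarrow> 0"
    unfolding \<eta>_def[abs_def] using tendsto_add[OF tendsto_add[OF lim1 lim2] lim3] by simp
  \<comment> \<open>With \<open>k\<close> and \<open>q\<close> at most n/4, n-k-q keeps half of n.
    The inequality between powers of n absorbs the logarithm in \<open>y\<close>, and the lower
    bounds on \<epsilon> log n and \<rho> log n pay for rounding \<open>q\<close> and
    \<open>r\<close>.\<close>
  have "\<forall>\<^sub>F n::nat in sequentially. 2 \<le> n" by (rule eventually_ge_at_top)
  moreover have "\<forall>\<^sub>F n::nat in sequentially. real n powr \<alpha> \<le> real n / 4"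
    using \<alpha> by real_asymp
  moreover have "\<forall>\<^sub>F n::nat in sequentially. 2 * log 2 n < real n / 4"
    by real_asymp
  moreover have "\<forall>\<^sub>F n::nat in sequentially.
      4 * log 2 n * n powr (- 3 * (1 - \<alpha>) / 4) \<le> n powr (- (1 - \<alpha>) / 2)"
    using \<alpha> by real_asymp
  moreover have "\<forall>\<^sub>F n::nat in sequentially. 1 \<le> \<epsilon> * log 2 n"
    using \<epsilon> by real_asymp
  moreover have "\<forall>\<^sub>F n::nat in sequentially. 2 \<le> \<rho> * log 2 n"
    using \<rho> by real_asymp
  moreover have "\<forall>\<^sub>F n::nat in sequentially. X n \<le> 1 / 2"
    unfolding X_def using \<epsilon> by real_asymp
  ultimately have "\<forall>\<^sub>F n in sequentially. \<forall>P\<subseteq>{..<n}. card P = nat \<lfloor>real n powr \<alpha>\<rfloor> \<longrightarrow>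
    measure (random_graph n) {E. \<not> (\<forall>q.
      real (card (overlap_cliques n (E \<union> all_pairs P) P (nat \<lfloor>\<rho> * log 2 n\<rfloor>) q)) \<le>
        2 * 2 powr (- \<kappa> * (log 2 n)\<^sup>2 / 2) *
          real (card (overlap_cliques n (E \<union> all_pairs P) P 0 q)))} \<le> \<eta> n"
  proof eventually_elim
    case (elim n)
    define L where "L = log 2 (real n)"
    define k where "k = nat \<lfloor>real n powr \<alpha>\<rfloor>"
    define r where "r = nat \<lfloor>\<rho> * L\<rfloor>"
    define q where "q = nat \<lceil>(2 - \<epsilon>) * L\<rceil>"
    \<comment> \<open>Half of the available exponent: the ratio of counts and the Markov failure
      probability \<open>y ^ r / s\<close> are then both of order \<open>s\<close>.\<close>
    define s where "s = 2 powr (- \<kappa> * L\<^sup>2 / 2)"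
    define x where "x = (real q)\<^sup>2 * sqrt 2 ^ q / real (n - k)"
    define y where "y = real k * real q * sqrt 2 ^ r / (real (n - k) - real q)"
    have n: "real n = 2 powr L" and n0: "0 < real n" using elim(1) by (simp_all add: L_def)
    have n_powr: "real n powr t = 2 powr (L * t)" for t by (simp add: n powr_powr)
    have sqrt2: "sqrt 2 ^ j = 2 powr (real j / 2)" for j
      by (simp add: powr_half_sqrt[symmetric] powr_powr flip: powr_realpow)
    have L: "1 \<le> \<epsilon> * L" "2 \<le> \<rho> * L" using elim unfolding L_def by auto
    have L1: "1 \<le> L"
    proof -
      have "0 < \<epsilon> * L" using L(1) by linarith
      then have "0 < L" using \<epsilon> by (simp add: zero_less_mult_iff)
      then have "\<epsilon> * L \<le> 1 * L" using \<epsilon>1 by (intro mult_right_mono) auto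
      then show ?thesis using L(1) by linarith
    qed
    have k: "real k \<le> real n powr \<alpha>" unfolding k_def by (simp add: of_nat_floor)
    have q_ge: "(2 - \<epsilon>) * L \<le> real q" unfolding q_def by linarith
    have "0 \<le> (2 - \<epsilon>) * L" using \<epsilon>1 L1 by simp
    then have q_le: "real q \<le> (2 - \<epsilon>) * L + 1" unfolding q_def by linarith
    then have q2L: "real q \<le> 2 * L" using L by (simp add: algebra_simps)
    have kn: "real k \<le> real n / 4" and qn: "real q < real n / 4"
      using k q2L elim unfolding L_def by linarith+
    then have kn': "k \<le> n" by simp
    have half: "real n / 2 \<le> real (n - k) - real q" and half': "real n / 2 \<le> real (n - k)"
      using kn qn kn' by (simp_all add: of_nat_diff)
    have qN: "q < n - k" using half n0 by linarith
    have r_le: "real r \<le> \<rho> * L" and r_ge: "\<rho> * L / 2 \<le> real r"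
      unfolding r_def using L by linarith+
    have rq: "r \<le> q"
    proof -
      have "\<rho> * L \<le> (2 - \<epsilon>) * L" using \<rho> \<alpha> \<epsilon>1 L1 by (intro mult_right_mono) auto
      then show ?thesis using r_le q_ge by linarith
    qed
    have x_le: "x \<le> X n"
    proof -
      have "sqrt 2 ^ q \<le> 2 powr (L * (1 - \<epsilon> / 2) + 1)"
        unfolding sqrt2 using q_le by (intro powr_mono) (auto simp: algebra_simps)
      then have "x \<le> (2 * L)\<^sup>2 * 2 powr (L * (1 - \<epsilon> / 2) + 1) / (real n / 2)"
        unfolding x_def using q2L half' n0 by (intro frac_le mult_mono power_mono) auto
      also have "\<dots> = 16 * L\<^sup>2 * (2 powr (L * (1 - \<epsilon> / 2)) / 2 powr L)"
        by (simp add: n powr_add power2_eq_square)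
      also have "\<dots> = X n"
        unfolding X_def n_powr L_def[symmetric] powr_diff[symmetric] by (simp add: algebra_simps)
      finally show ?thesis .
    qed
    have x0: "0 \<le> x" by (simp add: x_def)
    have y0: "0 \<le> y" unfolding y_def using half n0 by (intro divide_nonneg_nonneg) auto
    \<comment> \<open>The exponents of n add up to \<alpha> + (1-\<alpha>)/4 - 1 = -3(1-\<alpha>)/4;
      a further (1-\<alpha>)/4 is given up for the factor 4 log n.\<close>
    have "y \<le> 2 powr (L * (- (1 - \<alpha>) / 2))"
    proof -
      have "sqrt 2 ^ r \<le> 2 powr (L * ((1 - \<alpha>) / 4))"
      proof -
        have "\<rho> * L \<le> (1 - \<alpha>) / 2 * L" using \<rho> L1 by (intro mult_right_mono) auto
        then show ?thesis unfolding sqrt2 using r_le by (intro powr_mono) (auto simp: mult.commute)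
      qed
      then have "y \<le> 2 powr (L * \<alpha>) * (2 * L) * 2 powr (L * ((1 - \<alpha>) / 4)) / (real n / 2)"
        unfolding y_def using k q2L half n0 unfolding n_powr
        by (intro frac_le mult_mono) auto
      also have "\<dots> = 4 * L * (2 powr (L * \<alpha>) * 2 powr (L * ((1 - \<alpha>) / 4)) / 2 powr L)"
        by (simp add: n)
      also have "\<dots> = 4 * L * 2 powr (L * (- 3 * (1 - \<alpha>) / 4))"
        unfolding powr_diff[symmetric] powr_add[symmetric] by (simp add: field_simps)
      also have "\<dots> \<le> 2 powr (L * (- (1 - \<alpha>) / 2))"
        using elim(4) unfolding n_powr L_def[symmetric] .
      finally show ?thesis .
    qed
    then have "y ^ r \<le> (2 powr (L * (- (1 - \<alpha>) / 2))) ^ r"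
      using y0 by (rule power_mono)
    also have "\<dots> = 2 powr (- (L * ((1 - \<alpha>) / 2) * real r))"
      by (simp add: powr_realpow[symmetric] powr_powr) (simp add: algebra_simps diff_divide_distrib)
    \<comment> \<open>Origin of \<kappa>: (1-\<alpha>)/2 from the base times \<rho>/2 from the lower
      bound on \<open>r\<close>.\<close>
    also have "\<dots> \<le> 2 powr (- \<kappa> * L\<^sup>2)"
    proof (rule powr_mono)
      have "L * ((1 - \<alpha>) / 2) * (\<rho> * L / 2) \<le> L * ((1 - \<alpha>) / 2) * real r"
        using r_ge L1 \<alpha> by (intro mult_left_mono) auto
      then show "- (L * ((1 - \<alpha>) / 2) * real r) \<le> - \<kappa> * L\<^sup>2"
        by (simp add: \<kappa>_def power2_eq_square mult_ac)
    qed simp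
    finally have yr: "y ^ r \<le> 2 powr (- \<kappa> * L\<^sup>2)" .
    have "real (n - k choose q) * (1 / 2) ^ (q choose 2) \<le> 2 powr (\<kappa> / 2 * L\<^sup>2 + L)"
    proof -
      have pw: "(1 / 2 :: real) ^ (q choose 2) = 2 powr (- (real q * (real q - 1) / 2))"
      proof -
        have eq: "real (q choose 2) = real q * (real q - 1) / 2"
          by (cases q) (auto simp: choose_two real_of_nat_div algebra_simps)
        show ?thesis
          unfolding eq[symmetric] by (simp add: powr_minus_divide power_one_over powr_realpow)
      qed
      have "real (n - k choose q) \<le> real (n - k) ^ q"
        using of_nat_mono[OF binomial_le_pow[OF less_imp_le[OF qN]], where 'a=real]
        by (simp only: of_nat_power)
      also have "\<dots> \<le> real n ^ q" by (intro power_mono) auto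
      also have "\<dots> = 2 powr (L * real q)" by (simp add: n powr_powr flip: powr_realpow)
      finally have "real (n - k choose q) * (1 / 2) ^ (q choose 2) \<le>
          2 powr (L * real q) * 2 powr (- (real q * (real q - 1) / 2))"
        unfolding pw by (rule mult_right_mono) simp
      also have "2 powr (L * real q) * 2 powr (- (real q * (real q - 1) / 2)) =
          2 powr (real q * (L - (real q - 1) / 2))"
        by (simp add: powr_add[symmetric] algebra_simps)
      also have "\<dots> \<le> 2 powr (2 * L * (\<epsilon> * L / 2 + 1 / 2))"
      proof (intro powr_mono)
        have "L - (real q - 1) / 2 \<le> \<epsilon> * L / 2 + 1 / 2" using q_ge by (simp add: field_simps)
        then have "real q * (L - (real q - 1) / 2) \<le> real q * (\<epsilon> * L / 2 + 1 / 2)"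
          by (rule mult_left_mono) simp
        also have "\<dots> \<le> 2 * L * (\<epsilon> * L / 2 + 1 / 2)"
          using q2L L by (intro mult_right_mono) auto
        finally show "real q * (L - (real q - 1) / 2) \<le> 2 * L * (\<epsilon> * L / 2 + 1 / 2)" .
      qed simp
      also have "\<dots> = 2 powr (\<kappa> / 2 * L\<^sup>2 + L)"
        by (simp add: \<epsilon>_def power2_eq_square algebra_simps)
      finally show ?thesis .
    qed
    then have "real (n - k choose q) * (1 / 2) ^ (q choose 2) * y ^ r \<le>
        2 powr (\<kappa> / 2 * L\<^sup>2 + L) * 2 powr (- \<kappa> * L\<^sup>2)"
      using yr y0 by (intro mult_mono) auto
    also have "\<dots> = 2 powr (L - \<kappa> / 2 * L\<^sup>2)"
      by (simp add: powr_add[symmetric] algebra_simps)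
    finally have third: "real (n - k choose q) * (1 / 2) ^ (q choose 2) * y ^ r \<le>
        2 powr (L - \<kappa> / 2 * L\<^sup>2)" .
    have s: "0 < s" by (simp add: s_def)
    have "y ^ r / s \<le> 2 powr (- \<kappa> * L\<^sup>2) / s"
      using yr s by (intro divide_right_mono) auto
    also have "\<dots> = s"
      unfolding s_def powr_diff[symmetric] by (simp add: field_simps)
    finally have "8 * x\<^sup>2 + y ^ r / s \<le> 8 * (X n)\<^sup>2 + s"
      using x_le x0 by (intro add_mono mult_left_mono power_mono) auto
    then have "real q * (8 * x\<^sup>2 + y ^ r / s) \<le> 2 * L * (8 * (X n)\<^sup>2 + s)"
      using q2L L1 s y0 by (intro mult_mono) auto
    with third have total: "real q * (8 * x\<^sup>2 + y ^ r / s) +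
        real (n - k choose q) * (1 / 2) ^ (q choose 2) * y ^ r \<le> \<eta> n"
      by (simp add: \<eta>_def L_def s_def distrib_left)
    show ?case
    proof (intro allI impI)
      fix P assume P: "P \<subseteq> {..<n}" "card P = nat \<lfloor>real n powr \<alpha>\<rfloor>"
      have "x \<le> 1 / 2" using x_le elim by linarith
      with prob_overlap_cliques_bad_le[OF P(1) P(2)[folded k_def] qN rq s]
      have "measure (random_graph n) {E. \<not> (\<forall>q.
          real (card (overlap_cliques n (E \<union> all_pairs P) P r q)) \<le>
            2 * s * real (card (overlap_cliques n (E \<union> all_pairs P) P 0 q)))} \<le>
        real q * (8 * x\<^sup>2 + y ^ r / s) + real (n - k choose q) * (1 / 2) ^ (q choose 2) * y ^ r"
        unfolding x_def y_def by blast
      also note total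
      finally show "measure (random_graph n) {E. \<not> (\<forall>q.
          real (card (overlap_cliques n (E \<union> all_pairs P) P (nat \<lfloor>\<rho> * log 2 n\<rfloor>) q)) \<le>
            2 * 2 powr (- \<kappa> * (log 2 n)\<^sup>2 / 2) *
              real (card (overlap_cliques n (E \<union> all_pairs P) P 0 q)))} \<le> \<eta> n"
        unfolding r_def s_def L_def .
    qed
  qed
  with lim show ?thesis by blast
qed

lemma tendsto_prob_planted_clique:
  fixes G :: "nat \<Rightarrow> (nat set set \<times> nat set) set"
  assumes lim: "\<eta> \<longlonglongrightarrow> 0"
    and bad: "\<forall>\<^sub>F n in sequentially. k n \<le> n \<and> (\<forall>P\<subseteq>{..<n}. card P = k n \<longrightarrow>
      measure (random_graph n) {E. (E \<union> all_pairs P, P) \<notin> G n} \<le> \<eta> n)"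
  shows "(\<lambda>n. measure_pmf.prob (planted_clique n (k n)) (G n)) \<longlonglongrightarrow> 1"
proof (rule tendsto_sandwich)
  show "\<forall>\<^sub>F n in sequentially. 1 - \<eta> n \<le> measure_pmf.prob (planted_clique n (k n)) (G n)"
    using bad
  proof eventually_elim
    case (elim n)
    then have "measure (planted_clique n (k n)) (- G n) \<le> \<eta> n"
      by (intro prob_planted_clique_le) auto
    then show ?case by (simp add: measure_pmf.prob_compl[of "G n", simplified] Compl_eq_Diff_UNIV)
  qed
  show "(\<lambda>n. 1 - \<eta> n) \<longlonglongrightarrow> 1" using tendsto_diff[OF tendsto_const lim, of 1] by simp
qed auto

text \<open>Both conclusions follow from the same slow-start bound. For recovery it is combined with
  r < k, so that reaching the planted clique means exceeding overlap \<open>r\<close>, and with n^d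
  lying eventually below exp(c log^2 n).\<close>

theorem theorem8p3:
  fixes \<alpha> \<gamma> :: real
  assumes "0 < \<alpha>" and "\<alpha> < 1" and "0 < \<gamma>"
  shows "\<exists>c>0.
    (\<lambda>n::nat. measure_pmf.prob (planted_clique n (nat \<lfloor>real n powr \<alpha>\<rfloor>))
      {(E, PC). \<forall>h m \<beta> Z a. st_params m \<beta> Z a \<longrightarrow>
        (\<exists>x\<in>st_states n E m.
          \<P>(\<omega> in st_dynamics n E h m \<beta> Z a x.
              ereal (exp (c * (log 2 (real n))\<^sup>2)) \<le>
                ereal_of_enat (hitting_time {(C, i). \<gamma> * log 2 (real n) \<le> real (card (C \<inter> PC))} \<omega>))
            \<ge> 1 - exp (- c * (log 2 (real n))\<^sup>2))})
      \<longlonglongrightarrow> 1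
    \<and> (\<forall>d::nat.
      (\<lambda>n::nat. measure_pmf.prob (planted_clique n (nat \<lfloor>real n powr \<alpha>\<rfloor>))
        {(E, PC). \<forall>h m \<beta> Z a. st_params m \<beta> Z a \<longrightarrow>
          (\<exists>x\<in>st_states n E m.
            \<P>(\<omega> in st_dynamics n E h m \<beta> Z a x. enat (n ^ d) < hitting_time {(C, i). C = PC} \<omega>)
              \<ge> 1 - exp (- c * (log 2 (real n))\<^sup>2))})
        \<longlonglongrightarrow> 1)"
proof -
  define \<rho> where "\<rho> = min \<gamma> (1 - \<alpha>) / 2"
  define \<kappa> where "\<kappa> = (1 - \<alpha>) * \<rho> / 4"
  \<comment> \<open>Then \<delta> is 2 exp(-4 c log^2 n), so \<open>T n\<close> steps cost about 2
    exp(-3 c log^2 n); the remaining room absorbs the 2 and the rounding of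
    \<open>T n\<close>.\<close>
  define c where "c = \<kappa> * ln 2 / 8"
  define k where "k n = nat \<lfloor>real n powr \<alpha>\<rfloor>" for n :: nat
  define r where "r n = nat \<lfloor>\<rho> * log 2 n\<rfloor>" for n :: nat
  define \<delta> where "\<delta> n = 2 * 2 powr (- \<kappa> * (log 2 (real n))\<^sup>2 / 2)" for n :: nat
  \<comment> \<open>Rounded up, so that every step count below the real-valued time bound is below
    \<open>T n\<close>.\<close>
  define T where "T n = nat \<lceil>exp (c * (log 2 (real n))\<^sup>2)\<rceil>" for n :: nat
  define good where "good n E P \<longleftrightarrow> (\<forall>q. real (card (overlap_cliques n E P (r n) q)) \<le>
    \<delta> n * real (card (overlap_cliques n E P 0 q)))" for n E P
  have \<rho>: "0 < \<rho>" "\<rho> \<le> (1 - \<alpha>) / 2" "\<rho> < \<gamma>" using assms by (auto simp: \<rho>_def)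
  have \<kappa>: "0 < \<kappa>" using assms \<rho> by (simp add: \<kappa>_def)
  have c: "0 < c" using \<kappa> by (simp add: c_def)
  obtain \<eta> where \<eta>: "\<eta> \<longlonglongrightarrow> 0"
    and bad: "\<forall>\<^sub>F n in sequentially. \<forall>P\<subseteq>{..<n}. card P = k n \<longrightarrow>
      measure (random_graph n) {E. \<not> good n (E \<union> all_pairs P) P} \<le> \<eta> n"
    using overlap_cliques_rare[OF assms(1,2) \<rho>(1,2)]
    unfolding good_def r_def \<delta>_def k_def \<kappa>_def by blast
  have slow: "\<exists>x\<in>st_states n E m. measure (st_dynamics n E h m \<beta> Z a x)
      {\<omega>. \<exists>s<T n. \<omega> s \<in> {(C, i). r n < card (C \<inter> P)}} \<le> real (T n) * \<delta> n"
    if "good n E P" "st_params m \<beta> Z a" for n E P m h \<beta> Z a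
    using st_slow_start[OF that(2), of n E P "r n" "\<delta> n" h "T n"] that(1)
    by (simp add: good_def case_prod_unfold)
  have small: "\<forall>\<^sub>F n in sequentially. real (T n) * \<delta> n \<le> exp (- c * (log 2 (real n))\<^sup>2)"
  proof -
    have "\<forall>\<^sub>F n::nat in sequentially. (exp (\<kappa> * ln 2 / 8 * (log 2 (real n))\<^sup>2) + 1) *
        (2 * 2 powr (- \<kappa> * (log 2 (real n))\<^sup>2 / 2)) \<le> exp (- (\<kappa> * ln 2 / 8) * (log 2 (real n))\<^sup>2)"
      using \<kappa> by real_asymp
    then show ?thesis
    proof eventually_elim
      case (elim n)
      have "real (T n) \<le> exp (\<kappa> * ln 2 / 8 * (log 2 (real n))\<^sup>2) + 1"
        unfolding T_def c_def
        using exp_ge_zero[of "\<kappa> * ln 2 / 8 * (log 2 (real n))\<^sup>2"] by linarith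
      then have "real (T n) * \<delta> n \<le> (exp (\<kappa> * ln 2 / 8 * (log 2 (real n))\<^sup>2) + 1) * \<delta> n"
        by (intro mult_right_mono) (auto simp: \<delta>_def)
      also have "\<dots> \<le> exp (- c * (log 2 (real n))\<^sup>2)"
        using elim unfolding \<delta>_def c_def .
      finally show ?case .
    qed
  qed
  have kn: "\<forall>\<^sub>F n in sequentially. k n \<le> n"
  proof -
    have "\<forall>\<^sub>F n::nat in sequentially. real n powr \<alpha> \<le> real n" using assms by real_asymp
    then show ?thesis by eventually_elim (simp add: k_def, linarith)
  qed
  have r_less: "\<forall>\<^sub>F n in sequentially. real (r n) < \<gamma> * log 2 (real n)"
    using eventually_ge_at_top[of 2]
  proof eventually_elim
    case (elim n)
    then have "0 < log 2 (real n)" by simp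
    then have "0 \<le> \<rho> * log 2 (real n)" "\<rho> * log 2 (real n) < \<gamma> * log 2 (real n)" using \<rho> by simp_all
    then show ?case unfolding r_def by linarith
  qed
  have less_T: "s < T n" if "real s < exp (c * (log 2 (real n))\<^sup>2)" for s n
    using that unfolding T_def by linarith
  let ?G1 = "\<lambda>n. {(E, PC). \<forall>h m \<beta> Z a. st_params m \<beta> Z a \<longrightarrow>
        (\<exists>x\<in>st_states n E m.
          \<P>(\<omega> in st_dynamics n E h m \<beta> Z a x.
              ereal (exp (c * (log 2 (real n))\<^sup>2)) \<le>
                ereal_of_enat (hitting_time {(C, i). \<gamma> * log 2 (real n) \<le> real (card (C \<inter> PC))} \<omega>))
            \<ge> 1 - exp (- c * (log 2 (real n))\<^sup>2))}"
  let ?G2 = "\<lambda>d n. {(E, PC). \<forall>h m \<beta> Z a. st_params m \<beta> Z a \<longrightarrow>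
          (\<exists>x\<in>st_states n E m.
            \<P>(\<omega> in st_dynamics n E h m \<beta> Z a x. enat (n ^ d) < hitting_time {(C, i). C = PC} \<omega>)
              \<ge> 1 - exp (- c * (log 2 (real n))\<^sup>2))}"
  have mono: "measure (random_graph n) {E. (E \<union> all_pairs P, P) \<notin> G} \<le> \<eta> n"
    if "measure (random_graph n) {E. \<not> good n (E \<union> all_pairs P) P} \<le> \<eta> n"
      and "\<And>E. good n E P \<Longrightarrow> (E, P) \<in> G" for n P G
    by (rule order.trans[OF measure_pmf.finite_measure_mono that(1)]) (use that(2) in auto)
  have first: "(\<lambda>n. measure_pmf.prob (planted_clique n (k n)) (?G1 n)) \<longlonglongrightarrow> 1"
  proof (rule tendsto_prob_planted_clique[OF \<eta>])
    show "\<forall>\<^sub>F n in sequentially. k n \<le> n \<and> (\<forall>P\<subseteq>{..<n}. card P = k n \<longrightarrow>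
      measure (random_graph n) {E. (E \<union> all_pairs P, P) \<notin> ?G1 n} \<le> \<eta> n)"
      using bad small kn r_less
    proof eventually_elim
      case (elim n)
      have G: "(E, P) \<in> ?G1 n" if good: "good n E P" for E P
      proof (rule CollectI, rule case_prodI, intro allI impI)
        fix h m \<beta> Z a assume "st_params m \<beta> Z a"
        from slow[OF good this, of h] obtain x where x: "x \<in> st_states n E m" and
          le: "measure (st_dynamics n E h m \<beta> Z a x)
            {\<omega>. \<exists>s<T n. \<omega> s \<in> {(C, i). r n < card (C \<inter> P)}} \<le> real (T n) * \<delta> n" by blast
        have le': "measure (st_dynamics n E h m \<beta> Z a x)
            {\<omega>. \<exists>s<T n. \<omega> s \<in> {(C, i). r n < card (C \<inter> P)}} \<le> exp (- c * (log 2 (real n))\<^sup>2)"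
          using le elim by linarith
        have "1 - exp (- c * (log 2 (real n))\<^sup>2) \<le> measure (st_dynamics n E h m \<beta> Z a x)
          {\<omega>. \<forall>s. real s < exp (c * (log 2 (real n))\<^sup>2) \<longrightarrow>
            \<omega> s \<notin> {(C, i). \<gamma> * log 2 (real n) \<le> real (card (C \<inter> P))}}"
          unfolding st_dynamics_def
          by (rule prob_avoid_ge[OF le'[unfolded st_dynamics_def]]) (use elim less_T in auto)
        then show "\<exists>x\<in>st_states n E m.
          \<P>(\<omega> in st_dynamics n E h m \<beta> Z a x.
              ereal (exp (c * (log 2 (real n))\<^sup>2)) \<le>
                ereal_of_enat (hitting_time {(C, i). \<gamma> * log 2 (real n) \<le> real (card (C \<inter> P))} \<omega>))
            \<ge> 1 - exp (- c * (log 2 (real n))\<^sup>2)"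
          unfolding le_hitting_time_iff
          by (intro bexI[OF _ x]) (simp add: st_dynamics_def)
      qed
      show ?case
      proof (intro conjI allI impI)
        show "k n \<le> n" using elim by blast
        fix P assume P: "P \<subseteq> {..<n}" "card P = k n"
        have "measure (random_graph n) {E. \<not> good n (E \<union> all_pairs P) P} \<le> \<eta> n"
          using elim(1) P by blast
        then show "measure (random_graph n) {E. (E \<union> all_pairs P, P) \<notin> ?G1 n} \<le> \<eta> n"
          by (rule mono) (rule G)
      qed
    qed
  qed
  have second: "(\<lambda>n. measure_pmf.prob (planted_clique n (k n)) (?G2 d n)) \<longlonglongrightarrow> 1" for d
  proof (rule tendsto_prob_planted_clique[OF \<eta>])
    have "\<forall>\<^sub>F n::nat in sequentially. real n ^ d < exp (c * (log 2 n)\<^sup>2)"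
      using c by real_asymp
    \<comment> \<open>The -1 pays for the floor in \<open>k n\<close> and gives
      \<open>r n < k n\<close>.\<close>
    moreover have "\<forall>\<^sub>F n::nat in sequentially. \<rho> * log 2 n < n powr \<alpha> - 1"
      using assms \<rho> by real_asymp
    ultimately show "\<forall>\<^sub>F n in sequentially. k n \<le> n \<and> (\<forall>P\<subseteq>{..<n}. card P = k n \<longrightarrow>
      measure (random_graph n) {E. (E \<union> all_pairs P, P) \<notin> ?G2 d n} \<le> \<eta> n)"
      using bad small kn eventually_ge_at_top[of 2]
    proof eventually_elim
      case (elim n)
      have "0 \<le> \<rho> * log 2 (real n)" using elim \<rho> by simp
      then have rk: "r n < k n" using elim(2) unfolding r_def k_def by linarith
      have G: "(E, P) \<in> ?G2 d n" if good: "good n E P" and P: "card P = k n" for E P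
      proof (rule CollectI, rule case_prodI, intro allI impI)
        fix h m \<beta> Z a assume "st_params m \<beta> Z a"
        from slow[OF good this, of h] obtain x where x: "x \<in> st_states n E m" and
          le: "measure (st_dynamics n E h m \<beta> Z a x)
            {\<omega>. \<exists>s<T n. \<omega> s \<in> {(C, i). r n < card (C \<inter> P)}} \<le> real (T n) * \<delta> n" by blast
        have le': "measure (st_dynamics n E h m \<beta> Z a x)
            {\<omega>. \<exists>s<T n. \<omega> s \<in> {(C, i). r n < card (C \<inter> P)}} \<le> exp (- c * (log 2 (real n))\<^sup>2)"
          using le elim by linarith
        have "s < T n" if "s \<le> n ^ d" for s
        proof (rule less_T)
          have "real s \<le> real n ^ d" using that by (simp flip: of_nat_power)
          with elim show "real s < exp (c * (log 2 (real n))\<^sup>2)" by linarith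
        qed
        then have "1 - exp (- c * (log 2 (real n))\<^sup>2) \<le> measure (st_dynamics n E h m \<beta> Z a x)
          {\<omega>. \<forall>s. s \<le> n ^ d \<longrightarrow> \<omega> s \<notin> {(C, i). C = P}}"
          unfolding st_dynamics_def
          by (intro prob_avoid_ge[OF le'[unfolded st_dynamics_def]]) (use rk P in auto)
        then show "\<exists>x\<in>st_states n E m.
            \<P>(\<omega> in st_dynamics n E h m \<beta> Z a x. enat (n ^ d) < hitting_time {(C, i). C = P} \<omega>)
              \<ge> 1 - exp (- c * (log 2 (real n))\<^sup>2)"
          unfolding less_hitting_time_iff
          by (intro bexI[OF _ x]) (simp add: st_dynamics_def)
      qed
      show ?case
      proof (intro conjI allI impI)
        show "k n \<le> n" using elim by blast
        fix P assume P: "P \<subseteq> {..<n}" "card P = k n"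
        have "measure (random_graph n) {E. \<not> good n (E \<union> all_pairs P) P} \<le> \<eta> n"
          using elim(3) P by blast
        then show "measure (random_graph n) {E. (E \<union> all_pairs P, P) \<notin> ?G2 d n} \<le> \<eta> n"
          by (rule mono) (rule G[OF _ P(2)])
      qed
    qed
  qed
  show ?thesis using c first second unfolding k_def by blast
qed

end
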